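(* Let $\Omega=((\Psi_n,M_n,P_n))_{n\in\mathbb{N}}$ be an admissible module-sequence on $L^2(\mathbb{R}^d)$ with output-generating atoms $\chi_n$, $n\in\mathbb{N}_0$, let $S_n\ge1$, $n\in\mathbb{N}$, be the pooling factors, and let $\Phi_\Omega^n(f)=\{(U[q]f)\ast\chi_n\}_{q\in\Lambda_1^n}$ denote the features of $f$ generated in the $n$-th network layer. Assume that the operators $M_n,P_n:L^2(\mathbb{R}^d)\to L^2(\mathbb{R}^d)$ commute with translations, i.e., $M_nT_tf=T_tM_nf$ and $P_nT_tf=T_tP_nf$ for all $f\in L^2(\mathbb{R}^d)$, $t\in\mathbb{R}^d$, $n\in\mathbb{N}$. If, in addition, there exists a constant $K>0$ (that does not depend on $n$) such that $$|\widehat{\chi_n}(\omega)|\,|\omega|\le K,\qquad\text{for a.e. }\omega\in\mathbb{R}^d,\ \text{for all }n\in\mathbb{N}_0,$$ then $$|||\Phi_\Omega^n(T_tf)-T_t\Phi_\Omega^n(f)|||\le2\pi|t|K\left|\frac{1}{S_1\cdots S_n}-1\right|\|f\|_2,$$ for all $f\in L^2(\mathbb{R}^d)$, $t\in\mathbb{R}^d$, and $n\in\mathbb{N}$, where $T_t\Phi_\Omega^n(f)$ refers to element-wise application of $T_t$, i.e., $T_t\Phi_\Omega^n(f)=\{T_t((U[q]f)\ast\chi_n)\}_{q\in\Lambda_1^n}$.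
   Context: Notation: $\mathbb{N}=\{1,2,\dots\}$, $\mathbb{N}_0=\mathbb{N}\cup\{0\}$; $L^2(\mathbb{R}^d)$ consists of complex-valued functions. $(T_tf)(x):=f(x-t)$; $(If)(x):=\overline{f(-x)}$; $\widehat f(\omega):=\int_{\mathbb{R}^d}f(x)e^{-2\pi i\langle x,\omega\rangle}dx$ for $f\in L^1(\mathbb{R}^d)$, extended as usual to $L^2(\mathbb{R}^d)$; $(f\ast g)(y):=\int_{\mathbb{R}^d}f(x)g(y-x)dx$; $|\cdot|$ is the Euclidean norm on $\mathbb{R}^d$. Semi-discrete frame: for a countable index set $\Lambda$ and atoms $\{g_\lambda\}_{\lambda\in\Lambda}\subseteq L^1(\mathbb{R}^d)\cap L^2(\mathbb{R}^d)$, the collection $\{T_bIg_\lambda\}_{(\lambda,b)\in\Lambda\times\mathbb{R}^d}$ is a semi-discrete frame for $L^2(\mathbb{R}^d)$ with frame bounds $A,B>0$ if $A\|f\|_2^2\le\sum_{\lambda\in\Lambda}\int_{\mathbb{R}^d}|\langle f,T_bIg_\lambda\rangle|^2db=\sum_{\lambda\in\Lambda}\|f\ast g_\lambda\|_2^2\le B\|f\|_2^2$ for all $f\in L^2(\mathbb{R}^d)$. Module-sequence: $\Omega=((\Psi_n,M_n,P_n))_{n\in\mathbb{N}}$ where, for each $n$, $\Psi_n=\{T_bIg_{\lambda_n}\}_{b\in\mathbb{R}^d,\,\lambda_n\in\widetilde\Lambda_n}$ is a semi-discrete frame for $L^2(\mathbb{R}^d)$ with countable index set $\widetilde\Lambda_n$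 and upper frame bound $B_n>0$, and $M_n,P_n:L^2(\mathbb{R}^d)\to L^2(\mathbb{R}^d)$ are (possibly non-linear) Lipschitz-continuous operators with Lipschitz constants $L_n>0$ and $R_n>0$ respectively (i.e., $\|M_nf-M_nh\|_2\le L_n\|f-h\|_2$ and $\|P_nf-P_nh\|_2\le R_n\|f-h\|_2$ for all $f,h$) and with $M_n0=0$, $P_n0=0$. To each layer $n\in\mathbb{N}$ is associated a pooling factor $S_n\ge1$. In each frame $\Psi_n$ one atom, with index $\lambda_n^\ast\in\widetilde\Lambda_n$, is designated as output-generating atom of layer $n-1$: $\chi_{n-1}:=g_{\lambda_n^\ast}$, $n\in\mathbb{N}$. Set $\Lambda_n:=\widetilde\Lambda_n\setminus\{\lambda_n^\ast\}$. $\Omega$ is called admissible if $\max\{B_n,B_nL_n^2R_n^2\}\le1$ for all $n\in\mathbb{N}$. Network: for $\lambda_n\in\Lambda_n$ and $f\in L^2(\mathbb{R}^d)$, $U_n[\lambda_n]f:=S_n^{d/2}\,P_n\big(M_n(f\ast g_{\lambda_n})\big)(S_n\,\cdot)$. Paths: $\Lambda_1^n:=\Lambda_1\times\cdots\times\Lambda_n$ for $n\in\mathbb{N}$, $\Lambda_1^0:=\{e\}$ with $e$ the empty path. For $q=(\lambda_1,\dots,\lambda_n)\in\Lambda_1^n$, $U[q]f:=U_n[\lambda_n]\cdots U_2[\lambda_2]U_1[\lambda_1]f$, and $U[e]f:=f$. For a family $s=\{s_q\}_q$ of functions in $L^2(\mathbb{R}^d)$ indexed by a countable set, $|||s|||:=(\sum_q\|s_q\|_2^2)^{1/2}$;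 differences of families are taken index-wise. *)

theory Defs
  imports "HOL-Analysis.Analysis"
begin

text \<open>
  Elements of \<open>L\<^sup>2\<close> are represented by Borel functions rather than by classes modulo
  null sets. Operators act on representatives; the Lipschitz condition below makes them respect
  almost-everywhere equality, and all identities between \<open>L\<^sup>2\<close> functions are stated almost
  everywhere. Norms take values in \<open>[0,\<infinity>]\<close>, so a finite bound on a norm includes convergence.
\<close>

type_synonym 'a cfun = "'a \<Rightarrow> complex"
type_synonym 'a cop = "'a cfun \<Rightarrow> 'a cfun"

definition L1 :: "'a::euclidean_space cfun set" where
  "L1 = {f. integrable lborel f}"

definition L2 :: "'a::euclidean_space cfun set" where
  "L2 = {f. f \<in> borel_measurable lborel \<and> integrable lborel (\<lambda>x. (norm (f x))\<^sup>2)}"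

definition ennreal_sqrt :: "ennreal \<Rightarrow> ennreal" where
  "ennreal_sqrt x = (if x = top then top else ennreal (sqrt (enn2real x)))"

definition l2norm :: "'a::euclidean_space cfun \<Rightarrow> ennreal" where
  "l2norm f = ennreal_sqrt (\<integral>\<^sup>+x. ennreal ((norm (f x))\<^sup>2) \<partial>lborel)"

definition l2inner :: "'a::euclidean_space cfun \<Rightarrow> 'a cfun \<Rightarrow> complex" where
  "l2inner f h = (\<integral>x. f x * cnj (h x) \<partial>lborel)"

definition translate :: "'a::euclidean_space \<Rightarrow> 'a cop" where
  "translate t f = (\<lambda>x. f (x - t))"

definition involution :: "'a::euclidean_space cop" where
  "involution f = (\<lambda>x. cnj (f (- x)))"

text \<open>Only applied to functions in \<open>L1\<close>, so the extension to \<open>L\<^sup>2\<close> is not needed.\<close>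

definition fourier :: "'a::euclidean_space cop" where
  "fourier f \<omega> =
    (\<integral>x. f x * exp (- 2 * complex_of_real pi * \<i> * complex_of_real (x \<bullet> \<omega>)) \<partial>lborel)"

definition convolve :: "'a::euclidean_space cfun \<Rightarrow> 'a cop" where
  "convolve f g y = (\<integral>x. f x * g (y - x) \<partial>lborel)"

definition semi_discrete_frame ::
  "'i set \<Rightarrow> ('i \<Rightarrow> 'a::euclidean_space cfun) \<Rightarrow> real \<Rightarrow> real \<Rightarrow> bool" where
  "semi_discrete_frame \<Lambda> g A B \<longleftrightarrow>
    countable \<Lambda> \<and> (\<forall>l\<in>\<Lambda>. g l \<in> L1 \<inter> L2) \<and> A > 0 \<and> B > 0 \<and>
    (\<forall>f\<in>L2.
      ennreal A * (l2norm f)\<^sup>2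
        \<le> (\<Sum>\<^sub>\<infinity>l\<in>\<Lambda>. \<integral>\<^sup>+b. ennreal ((norm (l2inner f (translate b (involution (g l)))))\<^sup>2) \<partial>lborel) \<and>
      (\<Sum>\<^sub>\<infinity>l\<in>\<Lambda>. \<integral>\<^sup>+b. ennreal ((norm (l2inner f (translate b (involution (g l)))))\<^sup>2) \<partial>lborel)
        \<le> ennreal B * (l2norm f)\<^sup>2)"

definition lipschitz_op :: "real \<Rightarrow> 'a::euclidean_space cop \<Rightarrow> bool" where
  "lipschitz_op C N \<longleftrightarrow>
    C > 0 \<and> (\<forall>f\<in>L2. N f \<in> L2) \<and>
    (\<forall>f\<in>L2. \<forall>h\<in>L2. l2norm (\<lambda>x. N f x - N h x) \<le> ennreal C * l2norm (\<lambda>x. f x - h x)) \<and>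
    (AE x in lborel. N (\<lambda>_. 0) x = 0)"

definition commutes_with_translations :: "'a::euclidean_space cop \<Rightarrow> bool" where
  "commutes_with_translations N \<longleftrightarrow>
    (\<forall>f\<in>L2. \<forall>t. AE x in lborel. N (translate t f) x = translate t (N f) x)"

text \<open>
  Layers are numbered from 1, and values at index 0 of the sequences below are irrelevant.
  \<open>\<Lambda> n\<close> is the full index set of the \<open>n\<close>-th frame and \<open>out n\<close> the index of its output-generating
  atom, which belongs to layer \<open>n - 1\<close>.
\<close>

definition module_sequence ::
  "(nat \<Rightarrow> 'i set) \<Rightarrow> (nat \<Rightarrow> 'i \<Rightarrow> 'a::euclidean_space cfun) \<Rightarrow> (nat \<Rightarrow> 'a cop) \<Rightarrow> (nat \<Rightarrow> 'a cop)
    \<Rightarrow> (nat \<Rightarrow> real) \<Rightarrow> (nat \<Rightarrow> real) \<Rightarrow> (nat \<Rightarrow> real) \<Rightarrow> bool" where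
  "module_sequence \<Lambda> g M P B L R \<longleftrightarrow>
    (\<forall>n\<ge>1. (\<exists>A. semi_discrete_frame (\<Lambda> n) (g n) A (B n)) \<and>
           lipschitz_op (L n) (M n) \<and> lipschitz_op (R n) (P n))"

definition admissible :: "(nat \<Rightarrow> real) \<Rightarrow> (nat \<Rightarrow> real) \<Rightarrow> (nat \<Rightarrow> real) \<Rightarrow> bool" where
  "admissible B L R \<longleftrightarrow> (\<forall>n\<ge>1. max (B n) (B n * (L n)\<^sup>2 * (R n)\<^sup>2) \<le> 1)"

definition output_atom :: "(nat \<Rightarrow> 'i \<Rightarrow> 'a cfun) \<Rightarrow> (nat \<Rightarrow> 'i) \<Rightarrow> nat \<Rightarrow> 'a cfun" where
  "output_atom g out n = g (Suc n) (out (Suc n))"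

definition layer_op ::
  "real \<Rightarrow> 'a::euclidean_space cop \<Rightarrow> 'a cop \<Rightarrow> 'a cfun \<Rightarrow> 'a cop" where
  "layer_op s M P h f =
    (\<lambda>x. complex_of_real (s powr (real DIM('a) / 2)) * P (M (convolve f h)) (s *\<^sub>R x))"

text \<open>A path of length \<open>n\<close> is an extensional function on \<open>{1..n}\<close>; for \<open>n = 0\<close> there is exactly one.\<close>

definition paths :: "(nat \<Rightarrow> 'i set) \<Rightarrow> (nat \<Rightarrow> 'i) \<Rightarrow> nat \<Rightarrow> (nat \<Rightarrow> 'i) set" where
  "paths \<Lambda> out n = (\<Pi>\<^sub>E k\<in>{1..n}. \<Lambda> k - {out k})"

primrec path_op ::
  "(nat \<Rightarrow> 'i \<Rightarrow> 'a::euclidean_space cfun) \<Rightarrow> (nat \<Rightarrow> 'a cop) \<Rightarrow> (nat \<Rightarrow> 'a cop) \<Rightarrow> (nat \<Rightarrow> real)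
    \<Rightarrow> nat \<Rightarrow> (nat \<Rightarrow> 'i) \<Rightarrow> 'a cop" where
  "path_op g M P S 0 q f = f"
| "path_op g M P S (Suc n) q f =
    layer_op (S (Suc n)) (M (Suc n)) (P (Suc n)) (g (Suc n) (q (Suc n))) (path_op g M P S n q f)"

definition features ::
  "(nat \<Rightarrow> 'i \<Rightarrow> 'a::euclidean_space cfun) \<Rightarrow> (nat \<Rightarrow> 'i) \<Rightarrow> (nat \<Rightarrow> 'a cop) \<Rightarrow> (nat \<Rightarrow> 'a cop)
    \<Rightarrow> (nat \<Rightarrow> real) \<Rightarrow> nat \<Rightarrow> 'a cfun \<Rightarrow> (nat \<Rightarrow> 'i) \<Rightarrow> 'a cfun" where
  "features g out M P S n f q = convolve (path_op g M P S n q f) (output_atom g out n)"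

definition family_norm :: "'q set \<Rightarrow> ('q \<Rightarrow> 'a::euclidean_space cfun) \<Rightarrow> ennreal" where
  "family_norm Q s = ennreal_sqrt (\<Sum>\<^sub>\<infinity>q\<in>Q. (l2norm (s q))\<^sup>2)"

end

(*
  Translating the input by t translates the n-th layer signals U[q]f by t / (S_1 ... S_n), since
  convolution, M_k and P_k commute with translations and dilation by S_k divides a shift by S_k.
  Hence the difference of features is the convolution of u = U[q]f with
  k = T_s chi_n - T_t chi_n, where s = t / (S_1 ... S_n), and the decay hypothesis gives
  |k^| <= 2 pi |s - t| K everywhere, because chi_n^ is continuous.

  That convolution with k has L^2 operator norm at most C = sup |k^| is shown for bounded
  integrable u as follows. With h = u * k, the autocorrelations a_h = h * Ih and a_u = u * Iu have
  Fourier transforms |h^|^2 <= C^2 |u^|^2. Integrating against a Gaussian probability measure turns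
  this into a comparison of Gaussian averages of a_h and a_u; as the averages concentrate at 0 the
  left side tends to a_h(0) = ||h||^2 by continuity of a_h, while |a_u| <= ||u||^2 throughout.
  Truncation and Fatou's lemma extend the bound to all u in L^2.

  Finally sum over q: admissibility and the upper frame bounds give sum_q ||U[q]f||^2 <= ||f||^2.
*)

theory Submission
  imports Defs "HOL-Probability.Characteristic_Functions"
begin

subsection \<open>Affine substitutions and the Fourier transform\<close>

lemma nn_integral_lborel_affine:
  fixes t :: "'a::euclidean_space"
  assumes [measurable]: "f \<in> borel_measurable borel" and c: "c \<noteq> 0"
  shows "(\<integral>\<^sup>+x. f x \<partial>lborel) = ennreal (\<bar>c\<bar> ^ DIM('a)) * (\<integral>\<^sup>+x. f (t + c *\<^sub>R x) \<partial>lborel)"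
  by (subst lborel_affine[OF c, of t])
     (simp add: nn_integral_density nn_integral_distr nn_integral_cmult)

lemma integrable_lborel_affine:
  fixes t :: "'a::euclidean_space" and f :: "'a \<Rightarrow> 'b::{banach, second_countable_topology}"
  assumes f: "integrable lborel f" and c: "c \<noteq> 0"
  shows "integrable lborel (\<lambda>x. f (t + c *\<^sub>R x))"
  using f f[THEN borel_measurable_integrable] c unfolding integrable_iff_bounded
  by (subst (asm) nn_integral_lborel_affine[where c=c and t=t]) (auto simp: ennreal_mult_less_top)

lemma integrable_lborel_affine_iff:
  fixes t :: "'a::euclidean_space" and f :: "'a \<Rightarrow> 'b::{banach, second_countable_topology}"
  assumes c: "c \<noteq> 0"
  shows "integrable lborel (\<lambda>x. f (t + c *\<^sub>R x)) \<longleftrightarrow> integrable lborel f"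
  using integrable_lborel_affine[of f c t] c
    integrable_lborel_affine[of "\<lambda>x. f (t + c *\<^sub>R x)" "1/c" "- (1/c) *\<^sub>R t"]
  by (auto simp: algebra_simps)

lemma integral_lborel_affine:
  fixes t :: "'a::euclidean_space" and f :: "'a \<Rightarrow> 'b::{banach, second_countable_topology}"
  assumes c: "c \<noteq> 0"
  shows "(\<integral>x. f x \<partial>lborel) = \<bar>c\<bar> ^ DIM('a) *\<^sub>R (\<integral>x. f (t + c *\<^sub>R x) \<partial>lborel)"
proof cases
  assume f[measurable]: "integrable lborel f" then show ?thesis
    using c f[THEN borel_measurable_integrable] integrable_lborel_affine[OF f c, of t]
    by (subst lborel_affine[OF c, of t]) (simp add: integral_density integral_distr)
next
  assume "\<not> integrable lborel f" with c show ?thesis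
    by (simp add: integrable_lborel_affine_iff not_integrable_integral_eq)
qed

lemma AE_lborel_affine:
  fixes t :: "'a::euclidean_space"
  assumes P: "AE x in lborel. P x" and c: "c \<noteq> 0"
  shows "AE x in lborel. P (t + c *\<^sub>R x)"
proof -
  obtain N where N: "{x. \<not> P x} \<subseteq> N" "N \<in> null_sets lborel"
    using P by (auto elim!: AE_E simp: null_sets_def)
  then have [measurable]: "N \<in> sets borel" by auto
  have "0 = emeasure lborel N" using N by auto
  also have "\<dots> = (\<integral>\<^sup>+x. indicator N x \<partial>lborel)" by simp
  also have "\<dots> = ennreal (\<bar>c\<bar> ^ DIM('a)) * (\<integral>\<^sup>+x. indicator N (t + c *\<^sub>R x) \<partial>lborel)"
    using c by (intro nn_integral_lborel_affine) auto
  finally have "(\<integral>\<^sup>+x. indicator N (t + c *\<^sub>R x) \<partial>lborel) = 0"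
    using c by simp
  then have "AE x in lborel. (indicator N (t + c *\<^sub>R x) :: ennreal) = 0"
    by (subst (asm) nn_integral_0_iff_AE) auto
  then show ?thesis
    by eventually_elim (use N in \<open>auto simp: indicator_def split: if_splits\<close>)
qed

lemma
  fixes t :: "'a::euclidean_space" and f :: "'a \<Rightarrow> 'b::{banach, second_countable_topology}"
  shows integrable_lborel_diff_right: "integrable lborel (\<lambda>x. f (x - t)) \<longleftrightarrow> integrable lborel f"
    and integral_lborel_diff_right: "(\<integral>x. f (x - t) \<partial>lborel) = (\<integral>x. f x \<partial>lborel)"
    and integrable_lborel_diff_left: "integrable lborel (\<lambda>x. f (t - x)) \<longleftrightarrow> integrable lborel f"
    and integral_lborel_diff_left: "(\<integral>x. f (t - x) \<partial>lborel) = (\<integral>x. f x \<partial>lborel)"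
    and integrable_lborel_uminus: "integrable lborel (\<lambda>x. f (- x)) \<longleftrightarrow> integrable lborel f"
    and integral_lborel_uminus: "(\<integral>x. f (- x) \<partial>lborel) = (\<integral>x. f x \<partial>lborel)"
  using integrable_lborel_affine_iff[of 1 f "-t"] integral_lborel_affine[of 1 f "-t"]
    integrable_lborel_affine_iff[of "-1" f t] integral_lborel_affine[of "-1" f t]
    integrable_lborel_affine_iff[of "-1" f 0] integral_lborel_affine[of "-1" f 0]
  by simp_all

lemma norm_fourier_kernel [simp]:
  "norm (exp (- 2 * complex_of_real pi * \<i> * complex_of_real a)) = 1"
  "norm (exp (- (2 * complex_of_real pi * \<i> * complex_of_real a))) = 1"
  using norm_exp_i_times[of "- 2 * pi * a"] by (simp_all add: mult_ac)

lemma integrable_fourier_kernel: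
  assumes "integrable lborel (f :: 'a::euclidean_space cfun)"
  shows "integrable lborel (\<lambda>x. f x * exp (- 2 * complex_of_real pi * \<i> * complex_of_real (x \<bullet> w)))"
proof (rule Bochner_Integration.integrable_bound[OF assms])
  have [measurable]: "f \<in> borel_measurable borel"
    using assms by auto
  show "(\<lambda>x. f x * exp (- 2 * complex_of_real pi * \<i> * complex_of_real (x \<bullet> w))) \<in> borel_measurable lborel"
    by measurable
qed (auto simp: norm_mult)

lemma continuous_fourier:
  assumes f: "integrable lborel (f :: 'a::euclidean_space cfun)"
  shows "continuous_on UNIV (fourier f)"
proof -
  have "(\<lambda>n. fourier f (X n)) \<longlonglongrightarrow> fourier f w" if X: "X \<longlonglongrightarrow> w" for X w
    unfolding fourier_def
  proof (rule integral_dominated_convergence[where w="\<lambda>x. norm (f x)"])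
    show "AE x in lborel. (\<lambda>n. f x * exp (- 2 * complex_of_real pi * \<i> * complex_of_real (x \<bullet> X n)))
        \<longlonglongrightarrow> f x * exp (- 2 * complex_of_real pi * \<i> * complex_of_real (x \<bullet> w))"
      by (intro AE_I2 tendsto_intros X)
  qed (use f in \<open>auto simp: norm_mult\<close>)
  then show ?thesis
    by (auto simp: continuous_on_eq_continuous_at continuous_at_sequentially o_def)
qed

lemma
  assumes f: "integrable lborel (f :: 'a::euclidean_space cfun)" and g: "integrable lborel g"
  shows integrable_convolve: "integrable lborel (convolve f g)"
    and fourier_convolve: "fourier (convolve f g) w = fourier f w * fourier g w"
proof -
  have [measurable]: "f \<in> borel_measurable borel" "g \<in> borel_measurable borel"
    using f g by auto
  have 1: "integrable (lborel \<Otimes>\<^sub>M lborel) (\<lambda>(x, y). f x * g (y - x))"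
  proof (rule lborel_pair.Fubini_integrable)
    have "(\<lambda>x. \<integral>y. norm (case (x, y) of (x, y) \<Rightarrow> f x * g (y - x)) \<partial>lborel)
        = (\<lambda>x. norm (f x) * (\<integral>y. norm (g y) \<partial>lborel))"
      using integral_lborel_diff_right[of "\<lambda>y. norm (g y)"] by (simp add: norm_mult)
    then show "integrable lborel (\<lambda>x. \<integral>y. norm (case (x, y) of (x, y) \<Rightarrow> f x * g (y - x)) \<partial>lborel)"
      using f by simp
    show "AE x in lborel. integrable lborel (\<lambda>y. case (x, y) of (x, y) \<Rightarrow> f x * g (y - x))"
      using g by (simp add: integrable_lborel_diff_right)
  qed measurable
  show "integrable lborel (convolve f g)"
    using lborel_pair.integrable_snd[OF 1] by (simp add: convolve_def[abs_def])
  define e where "e x = exp (- 2 * complex_of_real pi * \<i> * complex_of_real (x \<bullet> w))" for x :: 'a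
  have [measurable]: "e \<in> borel_measurable borel"
    unfolding e_def by measurable
  have e_diff: "e y = e x * e (y - x)" for x y
    unfolding e_def by (simp add: exp_add[symmetric] algebra_simps inner_diff_left)
  have 2: "integrable (lborel \<Otimes>\<^sub>M lborel) (\<lambda>(x, y). f x * g (y - x) * e y)"
    by (rule Bochner_Integration.integrable_bound[OF 1]) (auto simp: norm_mult e_def)
  have "fourier (convolve f g) w = (\<integral>y. (\<integral>x. f x * g (y - x) * e y \<partial>lborel) \<partial>lborel)"
    by (simp add: fourier_def convolve_def e_def)
  also have "\<dots> = (\<integral>x. (\<integral>y. f x * g (y - x) * e y \<partial>lborel) \<partial>lborel)"
    using lborel_pair.Fubini_integral[OF 2] by simp
  also have "\<dots> = (\<integral>x. (\<integral>y. (f x * e x) * (g (y - x) * e (y - x)) \<partial>lborel) \<partial>lborel)"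
  proof (intro Bochner_Integration.integral_cong refl)
    show "f x * g (y - x) * e y = (f x * e x) * (g (y - x) * e (y - x))" for x y
      using e_diff[of y x] by simp
  qed
  also have "\<dots> = fourier f w * fourier g w"
    using integral_lborel_diff_right[of "\<lambda>y. g y * e y"] by (simp add: fourier_def e_def)
  finally show "fourier (convolve f g) w = fourier f w * fourier g w" .
qed

lemma integrable_involution:
  "integrable lborel (f :: 'a::euclidean_space cfun) \<Longrightarrow> integrable lborel (involution f)"
  by (simp add: involution_def integrable_lborel_uminus)

lemma fourier_involution: "fourier (involution (f :: 'a::euclidean_space cfun)) w = cnj (fourier f w)"
proof -
  have "fourier (involution f) w
      = (\<integral>x. cnj (f (- x)) * exp (- 2 * complex_of_real pi * \<i> * complex_of_real (x \<bullet> w)) \<partial>lborel)"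
    by (simp add: fourier_def involution_def)
  also have "\<dots> = (\<integral>x. cnj (f x) * exp (- 2 * complex_of_real pi * \<i> * complex_of_real (- x \<bullet> w)) \<partial>lborel)"
    by (subst integral_lborel_uminus[symmetric]) simp
  also have "\<dots> = (\<integral>x. cnj (f x * exp (- 2 * complex_of_real pi * \<i> * complex_of_real (x \<bullet> w))) \<partial>lborel)"
    by (simp add: exp_cnj)
  also have "\<dots> = cnj (fourier f w)"
    unfolding fourier_def by (simp only: Bochner_Integration.integral_cnj)
  finally show ?thesis .
qed

lemma fourier_translate:
  "fourier (translate t (f :: 'a::euclidean_space cfun)) w
    = exp (- 2 * complex_of_real pi * \<i> * complex_of_real (t \<bullet> w)) * fourier f w"
proof -
  have "fourier (translate t f) w = (\<integral>x. exp (- 2 * complex_of_real pi * \<i> * complex_of_real (t \<bullet> w)) *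
      (f (x - t) * exp (- 2 * complex_of_real pi * \<i> * complex_of_real ((x - t) \<bullet> w))) \<partial>lborel)"
    unfolding fourier_def translate_def
    by (intro Bochner_Integration.integral_cong refl)
       (simp add: exp_add[symmetric] algebra_simps inner_diff_left)
  then show ?thesis
    using integral_lborel_diff_right[of "\<lambda>x. f x * exp (- 2 * complex_of_real pi * \<i> * complex_of_real (x \<bullet> w))" t]
    by (simp add: fourier_def)
qed

lemma norm_power2_eq_sum_Basis: "(norm (x::'a::euclidean_space))\<^sup>2 = (\<Sum>b\<in>Basis. (x \<bullet> b)\<^sup>2)"
  unfolding power2_norm_eq_inner by (subst euclidean_inner) (simp add: power2_eq_square)

lemma exists_gaussian_measure:
  obtains N :: "'a::euclidean_space measure" where "prob_space N" "sets N = sets borel"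
    "\<And>x. (\<integral>w. exp (\<i> * complex_of_real (x \<bullet> w)) \<partial>N) = complex_of_real (exp (- (norm x)\<^sup>2 / 2))"
proof -
  let ?G = "\<lambda>_::'a. std_normal_distribution"
  let ?T = "\<lambda>f::'a \<Rightarrow> real. \<Sum>b\<in>Basis. f b *\<^sub>R b"
  interpret G: prob_space std_normal_distribution
    by (rule prob_space_normal_density) simp
  interpret P: product_prob_space ?G Basis
    by unfold_locales
  interpret P: finite_product_prob_space ?G Basis
    by unfold_locales simp
  have T[measurable]: "?T \<in> measurable (PiM Basis ?G) borel"
    by measurable
  let ?N = "distr (PiM Basis ?G) borel ?T"
  show thesis
  proof
    show "prob_space ?N" by (rule P.prob_space_distr) (rule T)
    show "sets ?N = sets borel" by simp
    fix x :: 'a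
    have "(\<integral>w. exp (\<i> * complex_of_real (x \<bullet> w)) \<partial>?N)
        = (\<integral>f. exp (\<i> * complex_of_real (x \<bullet> ?T f)) \<partial>PiM Basis ?G)"
      by (rule integral_distr) auto
    also have "\<dots> = (\<integral>f. (\<Prod>b\<in>Basis. exp (\<i> * complex_of_real ((x \<bullet> b) * f b))) \<partial>PiM Basis ?G)"
      by (simp add: inner_sum_right exp_sum sum_distrib_left mult_ac)
    also have "\<dots> = (\<Prod>b\<in>Basis. (\<integral>y. exp (\<i> * complex_of_real ((x \<bullet> b) * y)) \<partial>std_normal_distribution))"
      by (rule P.product_integral_prod) (auto intro!: G.integrable_iexp)
    also have "\<dots> = (\<Prod>b\<in>Basis. complex_of_real (exp (- ((x \<bullet> b)\<^sup>2) / 2)))"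
      using char_std_normal_distribution by (simp add: char_def fun_eq_iff)
    also have "\<dots> = complex_of_real (exp (\<Sum>b\<in>Basis. - ((x \<bullet> b)\<^sup>2) / 2))"
      by (simp add: exp_sum)
    also have "(\<Sum>b\<in>Basis. - ((x \<bullet> b)\<^sup>2) / 2) = - (norm x)\<^sup>2 / 2"
      by (simp add: norm_power2_eq_sum_Basis sum_negf sum_divide_distrib)
    finally show "(\<integral>w. exp (\<i> * complex_of_real (x \<bullet> w)) \<partial>?N)
      = complex_of_real (exp (- (norm x)\<^sup>2 / 2))" .
  qed
qed

lemma integrable_gaussian:
  "integrable lborel (\<lambda>x::'a::euclidean_space. exp (- (norm x)\<^sup>2 / 2))"
proof -
  interpret P: product_sigma_finite "\<lambda>_::'a. lborel :: real measure" by unfold_locales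
  let ?T = "\<lambda>f::'a \<Rightarrow> real. \<Sum>b\<in>Basis. f b *\<^sub>R b"
  have 1: "integrable lborel (\<lambda>y::real. exp (- y\<^sup>2 / 2))"
    using integrable_mult_right[OF integrable_std_normal_moment[of 0], of "sqrt (2 * pi)"]
    unfolding std_normal_density_def by simp
  have "integrable (PiM Basis (\<lambda>_::'a. lborel)) (\<lambda>f. \<Prod>b\<in>Basis. exp (- (f b)\<^sup>2 / 2) :: real)"
    by (rule P.product_integrable_prod) (use 1 in auto)
  moreover have "(\<Prod>b\<in>Basis. exp (- (f b)\<^sup>2 / 2)) = exp (- (norm (?T f))\<^sup>2 / 2)" for f
    by (simp add: exp_sum[symmetric] norm_power2_eq_sum_Basis sum_negf sum_divide_distrib[symmetric]
        inner_sum_left_Basis)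
  ultimately have "integrable (PiM Basis (\<lambda>_::'a. lborel)) (\<lambda>f. exp (- (norm (?T f))\<^sup>2 / 2))"
    by simp
  then show ?thesis
    by (subst lborel_eq) (auto simp: integrable_distr_eq)
qed

subsection \<open>Continuity of translations and autocorrelations\<close>

lemma norm_diff_le_three:
  "norm (a - b :: complex) \<le> norm (a - c) + (norm (c - d) + norm (b - d))"
proof -
  have "norm (a - b) = norm ((a - c) + ((c - d) + (d - b)))" by simp
  also have "\<dots> \<le> norm (a - c) + (norm (c - d) + norm (d - b))"
    by (intro order_trans[OF norm_triangle_ineq] add_left_mono norm_triangle_ineq)
  finally show ?thesis by (simp add: norm_minus_commute)
qed

lemma translation_continuous_L1_approx:
  fixes f :: "'a::euclidean_space cfun"
  assumes f: "integrable lborel f"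
    and approx: "\<And>e. e > 0 \<Longrightarrow> \<exists>g. integrable lborel g \<and> (\<integral>x. norm (f x - g x) \<partial>lborel) < e \<and>
      (\<lambda>n::nat. \<integral>x. norm (g (x - Z n) - g x) \<partial>lborel) \<longlonglongrightarrow> 0"
  shows "(\<lambda>n. \<integral>x. norm (f (x - Z n) - f x) \<partial>lborel) \<longlonglongrightarrow> 0"
proof (rule LIMSEQ_I)
  fix e :: real assume "e > 0"
  then obtain g where g: "integrable lborel g" and fg: "(\<integral>x. norm (f x - g x) \<partial>lborel) < e / 3"
    and lim: "(\<lambda>n. \<integral>x. norm (g (x - Z n) - g x) \<partial>lborel) \<longlonglongrightarrow> 0"
    using approx[of "e / 3"] by auto
  obtain n0 where n0: "\<And>n. n \<ge> n0 \<Longrightarrow> norm ((\<integral>x. norm (g (x - Z n) - g x) \<partial>lborel) - 0) < e / 3"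
    using LIMSEQ_D[OF lim, of "e / 3"] \<open>e > 0\<close> by auto
  have "norm ((\<integral>x. norm (f (x - Z n) - f x) \<partial>lborel) - 0) < e" if "n \<ge> n0" for n
  proof -
    have i: "integrable lborel (\<lambda>x. f (x - Z n))" "integrable lborel (\<lambda>x. g (x - Z n))"
      using f g by (simp_all add: integrable_lborel_diff_right)
    have "(\<integral>x. norm (f (x - Z n) - f x) \<partial>lborel)
        \<le> (\<integral>x. norm (f (x - Z n) - g (x - Z n)) + (norm (g (x - Z n) - g x) + norm (f x - g x)) \<partial>lborel)"
      using f g i
      by (intro integral_mono Bochner_Integration.integrable_norm Bochner_Integration.integrable_add
          Bochner_Integration.integrable_diff norm_diff_le_three)
    also have "\<dots> = (\<integral>x. norm (f (x - Z n) - g (x - Z n)) \<partial>lborel)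
        + ((\<integral>x. norm (g (x - Z n) - g x) \<partial>lborel) + (\<integral>x. norm (f x - g x) \<partial>lborel))"
      using f g i by simp
    also have "(\<integral>x. norm (f (x - Z n) - g (x - Z n)) \<partial>lborel) = (\<integral>x. norm (f x - g x) \<partial>lborel)"
      by (rule integral_lborel_diff_right)
    also have "(\<integral>x. norm (f x - g x) \<partial>lborel) + ((\<integral>x. norm (g (x - Z n) - g x) \<partial>lborel)
        + (\<integral>x. norm (f x - g x) \<partial>lborel)) < e"
      using n0[OF that] fg by auto
    finally show ?thesis by simp
  qed
  then show "\<exists>n0. \<forall>n\<ge>n0. norm ((\<integral>x. norm (f (x - Z n) - f x) \<partial>lborel) - 0) < e"
    by blast
qed

lemma translation_continuous_L1_open:
  fixes U :: "'a::euclidean_space set" and c :: complex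
  assumes U: "open U" "emeasure lborel U < \<infinity>" and Z: "Z \<longlonglongrightarrow> 0"
  shows "(\<lambda>n. \<integral>x. norm (indicator U (x - Z n) *\<^sub>R c - indicator U x *\<^sub>R c) \<partial>lborel) \<longlonglongrightarrow> 0"
proof -
  let ?i = "indicator U :: 'a \<Rightarrow> real"
  have [measurable]: "U \<in> sets borel" using U by auto
  have i: "integrable lborel ?i"
    using U by (simp add: integrable_indicator_iff)
  have iz: "integrable lborel (\<lambda>x. ?i (x - z))" for z
    using i by (simp add: integrable_lborel_diff_right)
  have "(\<lambda>n. \<integral>x. max 0 (?i x - ?i (x - Z n)) \<partial>lborel) \<longlonglongrightarrow> (\<integral>x. 0 \<partial>(lborel::'a measure))"
  proof (rule integral_dominated_convergence[where w="?i"])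
    show "AE x in lborel. (\<lambda>n. max 0 (?i x - ?i (x - Z n))) \<longlonglongrightarrow> 0"
    proof (rule AE_I2)
      fix x
      show "(\<lambda>n. max 0 (?i x - ?i (x - Z n))) \<longlonglongrightarrow> 0"
      proof (cases "x \<in> U")
        case True
        have "(\<lambda>n. x - Z n) \<longlonglongrightarrow> x - 0" by (intro tendsto_intros Z)
        then have "eventually (\<lambda>n. x - Z n \<in> U) sequentially"
          using True U by (intro topological_tendstoD) auto
        then show ?thesis
          by (intro tendsto_eventually) (auto elim!: eventually_mono)
      next
        case False
        then have "max 0 (?i x - ?i (x - Z n)) = 0" for n by (simp add: indicator_def)
        then show ?thesis by simp
      qed
    qed
  qed (use i in \<open>auto simp: indicator_def\<close>)
  then have lim: "(\<lambda>n. norm c * (2 * (\<integral>x. max 0 (?i x - ?i (x - Z n)) \<partial>lborel))) \<longlonglongrightarrow> 0"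
    by (intro tendsto_mult_right_zero) simp
  have "(\<integral>x. norm (indicator U (x - z) *\<^sub>R c - indicator U x *\<^sub>R c) \<partial>lborel)
      = norm c * (2 * (\<integral>x. max 0 (?i x - ?i (x - z)) \<partial>lborel))" for z
  proof -
    have "(\<integral>x. norm (indicator U (x - z) *\<^sub>R c - indicator U x *\<^sub>R c) \<partial>lborel)
      = (\<integral>x. norm c * (2 * max 0 (?i x - ?i (x - z)) - (?i x - ?i (x - z))) \<partial>lborel)"
      by (intro Bochner_Integration.integral_cong refl) (auto simp: indicator_def)
    also have "\<dots> = norm c * (2 * (\<integral>x. max 0 (?i x - ?i (x - z)) \<partial>lborel)
        - ((\<integral>x. ?i x \<partial>lborel) - (\<integral>x. ?i (x - z) \<partial>lborel)))"
      using i iz[of z] by simp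
    also have "(\<integral>x. ?i (x - z) \<partial>lborel) = (\<integral>x. ?i x \<partial>lborel)"
      by (rule integral_lborel_diff_right)
    finally show ?thesis by simp
  qed
  then show ?thesis using lim by (simp only:)
qed

lemma translation_continuous_L1:
  fixes f :: "'a::euclidean_space cfun"
  assumes "integrable lborel f" and Z: "Z \<longlonglongrightarrow> 0"
  shows "(\<lambda>n. \<integral>x. norm (f (x - Z n) - f x) \<partial>lborel) \<longlonglongrightarrow> 0"
  using assms(1)
proof (induction f rule: integrable_induct)
  case (base A c)
  then have A[measurable]: "A \<in> sets borel" by simp
  show ?case
  proof (rule translation_continuous_L1_approx)
    show "integrable lborel (\<lambda>x. indicator A x *\<^sub>R c)"
      using base by (intro integrable_scaleR_left) (simp add: integrable_indicator_iff)
    fix e :: real assume "e > 0"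
    define e' where "e' = e / (norm c + 1)"
    have "e' > 0" using \<open>e > 0\<close> by (auto simp: e'_def add_nonneg_pos)
    then obtain U where U: "open U" "A \<subseteq> U" "emeasure lborel (U - A) < ennreal e'"
      using outer_regular_lborel[OF A] by blast
    have [measurable]: "U \<in> sets borel" using U by auto
    have "emeasure lborel U = emeasure lborel A + emeasure lborel (U - A)"
      using U by (subst plus_emeasure) (auto intro!: arg_cong[where f="emeasure lborel"])
    also have "\<dots> < \<infinity>" using base U by (auto simp: less_top[symmetric])
    finally have Ufin: "emeasure lborel U < \<infinity>" .
    have m: "measure lborel (U - A) < e'"
    proof -
      have "emeasure lborel (U - A) < top" using U(3) by (rule less_trans) simp
      then show ?thesis using U(3) by (simp add: measure_def)
    qed
    have "(\<integral>x. norm (indicator A x *\<^sub>R c - indicator U x *\<^sub>R c) \<partial>lborel)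
      = (\<integral>x. indicator (U - A) x * norm c \<partial>lborel)"
      using U by (intro Bochner_Integration.integral_cong refl) (auto simp: indicator_def)
    also have "\<dots> = measure lborel (U - A) * norm c"
      by simp
    also have "\<dots> \<le> e' * norm c"
      using m by (intro mult_right_mono) auto
    also have "\<dots> < e' * (norm c + 1)"
      using \<open>e' > 0\<close> by simp
    also have "\<dots> = e"
      using norm_ge_zero[of c] unfolding e'_def by (simp del: norm_ge_zero)
    finally have lt: "(\<integral>x. norm (indicator A x *\<^sub>R c - indicator U x *\<^sub>R c) \<partial>lborel) < e" .
    have "integrable lborel (\<lambda>x. indicator U x *\<^sub>R c)"
      using Ufin by (intro integrable_scaleR_left) (simp add: integrable_indicator_iff)
    with lt show "\<exists>g. integrable lborel g \<and> (\<integral>x. norm (indicator A x *\<^sub>R c - g x) \<partial>lborel) < e \<and>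
      (\<lambda>n. \<integral>x. norm (g (x - Z n) - g x) \<partial>lborel) \<longlonglongrightarrow> 0"
      using translation_continuous_L1_open[OF U(1) Ufin Z, of c]
      by (intro exI[of _ "\<lambda>x. indicator U x *\<^sub>R c"] conjI)
  qed
next
  case (add f g)
  have "(\<lambda>n. (\<integral>x. norm (f (x - Z n) - f x) \<partial>lborel) + (\<integral>x. norm (g (x - Z n) - g x) \<partial>lborel)) \<longlonglongrightarrow> 0"
    using tendsto_add[OF add(3,4)] by simp
  then show ?case
  proof (rule tendsto_sandwich[OF always_eventually always_eventually tendsto_const, rotated 2]; intro allI)
    fix n
    have i: "integrable lborel (\<lambda>x. f (x - Z n))" "integrable lborel (\<lambda>x. g (x - Z n))"
      using add by (simp_all add: integrable_lborel_diff_right)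
    have "(\<integral>x. norm (f (x - Z n) + g (x - Z n) - (f x + g x)) \<partial>lborel)
      \<le> (\<integral>x. norm (f (x - Z n) - f x) + norm (g (x - Z n) - g x) \<partial>lborel)"
    proof (rule integral_mono)
      show "norm (f (x - Z n) + g (x - Z n) - (f x + g x)) \<le> norm (f (x - Z n) - f x) + norm (g (x - Z n) - g x)" for x
        unfolding add_diff_add by (rule norm_triangle_ineq)
    qed (intro Bochner_Integration.integrable_norm Bochner_Integration.integrable_add
          Bochner_Integration.integrable_diff add(1,2) i)+
    then show "(\<integral>x. norm (f (x - Z n) + g (x - Z n) - (f x + g x)) \<partial>lborel)
      \<le> (\<integral>x. norm (f (x - Z n) - f x) \<partial>lborel) + (\<integral>x. norm (g (x - Z n) - g x) \<partial>lborel)"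
      using add(1,2) i by simp
  qed simp
next
  case (lim f s)
  show ?case
  proof (rule translation_continuous_L1_approx[OF lim.hyps(4)])
    fix e :: real assume "e > 0"
    have "(\<lambda>i. \<integral>x. norm (f x - s i x) \<partial>lborel) \<longlonglongrightarrow> (\<integral>x. 0 \<partial>(lborel::'a measure))"
    proof (rule integral_dominated_convergence[where w="\<lambda>x. 3 * norm (f x)"])
      show "AE x in lborel. (\<lambda>i. norm (f x - s i x)) \<longlonglongrightarrow> 0"
      proof (rule AE_I2)
        fix x
        have "(\<lambda>i. s i x) \<longlonglongrightarrow> f x" using lim.hyps(2)[of x] by simp
        from tendsto_norm[OF tendsto_diff[OF tendsto_const[of "f x"] this]]
        show "(\<lambda>i. norm (f x - s i x)) \<longlonglongrightarrow> 0" by simp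
      qed
      show "AE x in lborel. norm (norm (f x - s i x)) \<le> 3 * norm (f x)" for i
      proof (rule AE_I2)
        fix x show "norm (norm (f x - s i x)) \<le> 3 * norm (f x)"
          using lim.hyps(3)[of x i] norm_triangle_ineq4[of "f x" "s i x"] by simp
      qed
    qed (use lim.hyps(1,4) in auto)
    then have "eventually (\<lambda>i. (\<integral>x. norm (f x - s i x) \<partial>lborel) < e) sequentially"
      using \<open>e > 0\<close> by (intro order_tendstoD) auto
    then obtain i where "(\<integral>x. norm (f x - s i x) \<partial>lborel) < e"
      by (auto simp: eventually_sequentially)
    then show "\<exists>g. integrable lborel g \<and> (\<integral>x. norm (f x - g x) \<partial>lborel) < e \<and>
      (\<lambda>n. \<integral>x. norm (g (x - Z n) - g x) \<partial>lborel) \<longlonglongrightarrow> 0"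
      using lim.hyps(1) lim.IH by (intro exI[of _ "s i"] conjI)
  qed
qed

lemma norm_mult_le_sum_squares: "norm (a * b :: complex) \<le> (norm a)\<^sup>2 + (norm b)\<^sup>2"
proof -
  have "norm a * norm b \<ge> 0" by simp
  with sum_squares_bound[of "norm a" "norm b"] show ?thesis
    unfolding norm_mult by linarith
qed

lemma L2_reflect:
  assumes "u \<in> L2"
  shows "integrable lborel (\<lambda>x. (norm (u (t - x)))\<^sup>2)"
  using assms integrable_lborel_diff_left[of "\<lambda>x. (norm (u x))\<^sup>2"] by (simp add: L2_def)

lemma integrable_convolve_L2:
  fixes u k :: "'a::euclidean_space cfun"
  assumes u: "u \<in> L2" and k: "k \<in> L2"
  shows "integrable lborel (\<lambda>x. u x * k (y - x))"
proof (rule Bochner_Integration.integrable_bound)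
  show "integrable lborel (\<lambda>x. (norm (u x))\<^sup>2 + (norm (k (y - x)))\<^sup>2)"
    using u L2_reflect[OF k] by (auto simp: L2_def)
  have [measurable]: "u \<in> borel_measurable borel" "k \<in> borel_measurable borel"
    using u k by (auto simp: L2_def)
  show "(\<lambda>x. u x * k (y - x)) \<in> borel_measurable lborel" by measurable
  show "AE x in lborel. norm (u x * k (y - x)) \<le> norm ((norm (u x))\<^sup>2 + (norm (k (y - x)))\<^sup>2)"
    using norm_mult_le_sum_squares by (auto intro!: AE_I2 simp: abs_of_nonneg)
qed

lemma involution_L2: "u \<in> L2 \<Longrightarrow> involution u \<in> L2"
proof -
  assume u: "u \<in> L2"
  then have [measurable]: "u \<in> borel_measurable borel" by (simp add: L2_def)
  have [measurable]: "cnj \<in> borel_measurable borel"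
    by (intro borel_measurable_continuous_onI continuous_intros)
  have "(\<lambda>x. cnj (u (- x))) \<in> borel_measurable borel" by measurable
  moreover have "integrable lborel (\<lambda>x. (norm (u (- x)))\<^sup>2)"
    using L2_reflect[OF u, of 0] by simp
  ultimately show ?thesis
    unfolding L2_def involution_def by simp
qed

lemma autocorrelation_0:
  "convolve u (involution u) 0 = complex_of_real (\<integral>x. (norm (u x))\<^sup>2 \<partial>lborel)"
proof -
  have "convolve u (involution u) 0 = (\<integral>x. complex_of_real ((norm (u x))\<^sup>2) \<partial>lborel)"
    unfolding convolve_def involution_def complex_norm_square by simp
  then show ?thesis by (simp only: integral_complex_of_real)
qed

lemma norm_autocorrelation_le:
  fixes u :: "'a::euclidean_space cfun"
  assumes u: "u \<in> L2"
  shows "norm (convolve u (involution u) z) \<le> (\<integral>x. (norm (u x))\<^sup>2 \<partial>lborel)"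
proof -
  have i: "integrable lborel (\<lambda>x. (norm (u x))\<^sup>2)" using u by (auto simp: L2_def)
  then have iz: "integrable lborel (\<lambda>x. (norm (u (x - z)))\<^sup>2)"
    using integrable_lborel_diff_right[of "\<lambda>x. (norm (u x))\<^sup>2"] by simp
  have "norm (convolve u (involution u) z) \<le> (\<integral>x. norm (u x * involution u (z - x)) \<partial>lborel)"
    unfolding convolve_def by (rule integral_norm_bound)
  also have "\<dots> \<le> (\<integral>x. ((norm (u x))\<^sup>2 + (norm (u (x - z)))\<^sup>2) / 2 \<partial>lborel)"
  proof (rule integral_mono)
    show "integrable lborel (\<lambda>x. norm (u x * involution u (z - x)))"
      using integrable_convolve_L2[OF u involution_L2[OF u]] by auto
    show "norm (u x * involution u (z - x)) \<le> ((norm (u x))\<^sup>2 + (norm (u (x - z)))\<^sup>2) / 2" for x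
      using sum_squares_bound[of "norm (u x)" "norm (u (x - z))"] by (simp add: norm_mult involution_def)
  qed (use i iz in auto)
  also have "\<dots> = (\<integral>x. (norm (u x))\<^sup>2 \<partial>lborel)"
    using i iz integral_lborel_diff_right[of "\<lambda>x. (norm (u x))\<^sup>2" z] by simp
  finally show ?thesis .
qed

lemma bounded_L1_imp_L2:
  fixes h :: "'a::euclidean_space cfun"
  assumes h: "integrable lborel h" and D: "\<And>x. norm (h x) \<le> D"
  shows "h \<in> L2"
proof -
  have m: "h \<in> borel_measurable lborel" using h by (rule borel_measurable_integrable)
  have "integrable lborel (\<lambda>x. (norm (h x))\<^sup>2)"
  proof (rule Bochner_Integration.integrable_bound)
    show "integrable lborel (\<lambda>x. D * norm (h x))"
      by (intro integrable_mult_right Bochner_Integration.integrable_norm h)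
    show "(\<lambda>x. (norm (h x))\<^sup>2) \<in> borel_measurable lborel"
      using m by simp
    show "AE x in lborel. norm ((norm (h x))\<^sup>2) \<le> norm (D * norm (h x))"
    proof (rule AE_I2)
      fix x
      have "norm (h x) * norm (h x) \<le> D * norm (h x)"
        by (intro mult_right_mono D norm_ge_zero)
      then show "norm ((norm (h x))\<^sup>2) \<le> norm (D * norm (h x))"
        by (simp add: power2_eq_square)
    qed
  qed
  with m show ?thesis by (simp add: L2_def)
qed

lemma autocorrelation_tendsto:
  fixes h :: "'a::euclidean_space cfun"
  assumes h: "integrable lborel h" and D: "\<And>x. norm (h x) \<le> D" and Z: "Z \<longlonglongrightarrow> 0"
  shows "(\<lambda>n. convolve h (involution h) (Z n)) \<longlonglongrightarrow> convolve h (involution h) 0"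
proof -
  have h2: "h \<in> L2" by (rule bounded_L1_imp_L2[OF h D])
  have "norm (convolve h (involution h) z - convolve h (involution h) 0)
      \<le> D * (\<integral>x. norm (h (x - z) - h x) \<partial>lborel)" for z
  proof -
    have hz: "integrable lborel (\<lambda>x. h (x - z))" using h by (simp add: integrable_lborel_diff_right)
    have i: "integrable lborel (\<lambda>x. h x * involution h (y - x))" for y
      by (rule integrable_convolve_L2[OF h2 involution_L2[OF h2]])
    have "convolve h (involution h) z - convolve h (involution h) 0
        = (\<integral>x. h x * cnj (h (x - z) - h x) \<partial>lborel)"
      unfolding convolve_def
      using Bochner_Integration.integral_diff[OF i[of z] i[of 0]]
      by (simp add: involution_def algebra_simps)
    also have "norm \<dots> \<le> (\<integral>x. norm (h x * cnj (h (x - z) - h x)) \<partial>lborel)"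
      by (rule integral_norm_bound)
    also have "\<dots> \<le> (\<integral>x. D * norm (h (x - z) - h x) \<partial>lborel)"
    proof (rule integral_mono)
      show "integrable lborel (\<lambda>x. norm (h x * cnj (h (x - z) - h x)))"
        using Bochner_Integration.integrable_diff[OF i[of z] i[of 0]]
        by (intro Bochner_Integration.integrable_norm) (simp add: involution_def algebra_simps)
      show "norm (h x * cnj (h (x - z) - h x)) \<le> D * norm (h (x - z) - h x)" for x
        unfolding norm_mult complex_mod_cnj by (intro mult_right_mono D) auto
      show "integrable lborel (\<lambda>x. D * norm (h (x - z) - h x))"
        by (intro integrable_mult_right Bochner_Integration.integrable_norm
            Bochner_Integration.integrable_diff h hz)
    qed
    finally show ?thesis by (simp only: integral_mult_right_zero)
  qed
  then have "\<forall>n. norm (convolve h (involution h) (Z n) - convolve h (involution h) 0)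
      \<le> D * (\<integral>x. norm (h (x - Z n) - h x) \<partial>lborel)" by blast
  then have "(\<lambda>n. convolve h (involution h) (Z n) - convolve h (involution h) 0) \<longlonglongrightarrow> 0"
    using tendsto_mult_right_zero[OF translation_continuous_L1[OF h Z], of D]
    by (rule Lim_null_comparison[OF always_eventually])
  then show ?thesis by (rule LIM_zero_cancel)
qed

subsection \<open>The operator norm of convolution on \<open>L\<^sup>2\<close>\<close>

lemma norm_fourier_le:
  assumes "integrable lborel (f :: 'a::euclidean_space cfun)"
  shows "norm (fourier f w) \<le> (\<integral>x. norm (f x) \<partial>lborel)"
  unfolding fourier_def by (rule order_trans[OF integral_norm_bound]) (simp add: norm_mult)

lemma integral_fourier_gaussian:
  fixes a :: "'a::euclidean_space cfun"
  assumes a: "integrable lborel a" and N: "prob_space N" "sets N = sets borel"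
    "\<And>x. (\<integral>w. exp (\<i> * complex_of_real (x \<bullet> w)) \<partial>N) = complex_of_real (exp (- (norm x)\<^sup>2 / 2))"
  shows "(\<integral>w. fourier a ((c / (2 * pi)) *\<^sub>R w) \<partial>N)
    = (\<integral>x. a x * complex_of_real (exp (- (norm (c *\<^sub>R x))\<^sup>2 / 2)) \<partial>lborel)"
proof -
  interpret N: prob_space N by fact
  interpret P: pair_sigma_finite N "lborel :: 'a measure" by unfold_locales
  note N(2)[measurable_cong]
  have [measurable]: "a \<in> borel_measurable borel" using a by auto
  let ?e = "\<lambda>w x::'a. exp (\<i> * complex_of_real (((- c) *\<^sub>R x) \<bullet> w))"
  have ne: "norm (?e w x) = 1" for w x by simp
  have int: "integrable (N \<Otimes>\<^sub>M lborel) (\<lambda>(w, x). a x * ?e w x)"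
  proof (rule P.Fubini_integrable)
    show "integrable N (\<lambda>w. \<integral>x. norm (case (w, x) of (w, x) \<Rightarrow> a x * ?e w x) \<partial>lborel)"
      unfolding prod.case norm_mult ne by simp
    show "AE w in N. integrable lborel (\<lambda>x. case (w, x) of (w, x) \<Rightarrow> a x * ?e w x)"
    proof (rule AE_I2)
      fix w
      show "integrable lborel (\<lambda>x. case (w, x) of (w, x) \<Rightarrow> a x * ?e w x)"
        unfolding prod.case
      proof (rule Bochner_Integration.integrable_bound[OF a])
        show "(\<lambda>x. a x * ?e w x) \<in> borel_measurable lborel" by measurable
      qed (simp add: norm_mult ne)
    qed
  qed measurable
  have "(\<integral>w. fourier a ((c / (2 * pi)) *\<^sub>R w) \<partial>N) = (\<integral>w. (\<integral>x. a x * ?e w x \<partial>lborel) \<partial>N)"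
    unfolding fourier_def
  proof (intro Bochner_Integration.integral_cong refl)
    fix w x :: 'a
    show "a x * exp (- 2 * complex_of_real pi * \<i> * complex_of_real (x \<bullet> (c / (2 * pi)) *\<^sub>R w)) = a x * ?e w x"
      by (simp add: field_simps)
  qed
  also have "\<dots> = (\<integral>x. (\<integral>w. a x * ?e w x \<partial>N) \<partial>lborel)"
    using P.Fubini_integral[OF int] by simp
  also have "\<dots> = (\<integral>x. a x * complex_of_real (exp (- (norm ((- c) *\<^sub>R x))\<^sup>2 / 2)) \<partial>lborel)"
    unfolding integral_mult_right_zero N(3) ..
  finally show ?thesis by simp
qed

lemma fourier_autocorrelation:
  assumes "integrable lborel (u :: 'a::euclidean_space cfun)"
  shows "fourier (convolve u (involution u)) w = complex_of_real ((norm (fourier u w))\<^sup>2)"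
  unfolding fourier_convolve[OF assms integrable_involution[OF assms]] fourier_involution complex_norm_square ..

text \<open>This replaces Plancherel's theorem: testing the autocorrelation of \<open>u \<star> k\<close> against a Gaussian
  of width \<open>1 / c\<close> instead of evaluating it at \<open>0\<close> avoids Fourier inversion. The limit
  \<open>c \<longlongrightarrow> \<infinity>\<close> is taken below.\<close>

lemma gaussian_autocorrelation_le:
  fixes u k :: "'a::euclidean_space cfun"
  assumes u: "integrable lborel u" and k: "integrable lborel k"
    and C: "\<And>w. norm (fourier k w) \<le> C"
    and c: "c > 0" and u2: "u \<in> L2"
  defines "h \<equiv> convolve u k"
  shows "(\<integral>y. Re (convolve h (involution h) ((1 / c) *\<^sub>R y)) * exp (- (norm y)\<^sup>2 / 2) \<partial>lborel)
    \<le> C\<^sup>2 * (\<integral>x. (norm (u x))\<^sup>2 \<partial>lborel) * (\<integral>y. exp (- (norm (y::'a))\<^sup>2 / 2) \<partial>lborel)"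
proof -
  obtain N :: "'a measure" where N: "prob_space N" "sets N = sets borel"
    "\<And>x. (\<integral>w. exp (\<i> * complex_of_real (x \<bullet> w)) \<partial>N) = complex_of_real (exp (- (norm x)\<^sup>2 / 2))"
    using exists_gaussian_measure by blast
  interpret N: prob_space N by fact
  note N(2)[measurable_cong]
  define r where "r = c / (2 * pi)"
  define \<phi> where "\<phi> = (\<lambda>y::'a. exp (- (norm y)\<^sup>2 / 2))"
  have \<phi>: "integrable lborel \<phi>" "\<And>y. \<phi> y \<ge> 0" "\<And>y. \<phi> y \<le> 1"
    using integrable_gaussian by (auto simp: \<phi>_def)
  have h: "integrable lborel h" unfolding h_def by (rule integrable_convolve[OF u k])
  have key: "(\<integral>w. (norm (fourier v (r *\<^sub>R w)))\<^sup>2 \<partial>N)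
      = (1 / c) ^ DIM('a) * (\<integral>y. Re (convolve v (involution v) ((1 / c) *\<^sub>R y)) * \<phi> y \<partial>lborel)"
    if v: "integrable lborel v" for v
  proof -
    define b where "b = convolve v (involution v)"
    have b: "integrable lborel b"
      unfolding b_def by (rule integrable_convolve[OF v integrable_involution[OF v]])
    have ib: "integrable lborel (\<lambda>x. b x * complex_of_real (\<phi> (c *\<^sub>R x)))"
    proof (rule Bochner_Integration.integrable_bound[OF b])
      have [measurable]: "b \<in> borel_measurable borel" using b by auto
      have [measurable]: "\<phi> \<in> borel_measurable borel" using \<phi> by auto
      show "(\<lambda>x. b x * complex_of_real (\<phi> (c *\<^sub>R x))) \<in> borel_measurable lborel" by measurable
      show "AE x in lborel. norm (b x * complex_of_real (\<phi> (c *\<^sub>R x))) \<le> norm (b x)"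
        using \<phi>(2,3) by (intro AE_I2) (simp add: norm_mult mult_left_le)
    qed
    have "complex_of_real (\<integral>w. (norm (fourier v (r *\<^sub>R w)))\<^sup>2 \<partial>N) = (\<integral>w. fourier b (r *\<^sub>R w) \<partial>N)"
      unfolding b_def fourier_autocorrelation[OF v] integral_complex_of_real ..
    also have "\<dots> = (\<integral>x. b x * complex_of_real (\<phi> (c *\<^sub>R x)) \<partial>lborel)"
      unfolding r_def \<phi>_def by (rule integral_fourier_gaussian[OF b N])
    finally have "(\<integral>w. (norm (fourier v (r *\<^sub>R w)))\<^sup>2 \<partial>N)
        = Re (\<integral>x. b x * complex_of_real (\<phi> (c *\<^sub>R x)) \<partial>lborel)"
      by (metis Re_complex_of_real)
    also have "\<dots> = (\<integral>x. Re (b x * complex_of_real (\<phi> (c *\<^sub>R x))) \<partial>lborel)"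
      by (rule integral_Re[OF ib, symmetric])
    also have "\<dots> = (\<integral>x. Re (b x) * \<phi> (c *\<^sub>R x) \<partial>lborel)"
      by simp
    also have "\<dots> = (1 / c) ^ DIM('a) * (\<integral>y. Re (b ((1 / c) *\<^sub>R y)) * \<phi> y \<partial>lborel)"
      using c by (subst integral_lborel_affine[where c="1 / c" and t=0]) auto
    finally show ?thesis unfolding b_def .
  qed
  have bd: "integrable N (\<lambda>w. (norm (fourier v (r *\<^sub>R w)))\<^sup>2)" if v: "integrable lborel v" for v
  proof (rule N.integrable_const_bound)
    have [measurable]: "fourier v \<in> borel_measurable borel"
      by (rule borel_measurable_continuous_onI[OF continuous_fourier[OF v]])
    show "(\<lambda>w. (norm (fourier v (r *\<^sub>R w)))\<^sup>2) \<in> borel_measurable N" by measurable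
    show "AE w in N. norm ((norm (fourier v (r *\<^sub>R w)))\<^sup>2) \<le> (\<integral>x. norm (v x) \<partial>lborel)\<^sup>2"
      using norm_fourier_le[OF v] by (intro AE_I2) (simp add: power_mono)
  qed
  have "(\<integral>w. (norm (fourier h (r *\<^sub>R w)))\<^sup>2 \<partial>N) \<le> (\<integral>w. C\<^sup>2 * (norm (fourier u (r *\<^sub>R w)))\<^sup>2 \<partial>N)"
  proof (rule integral_mono)
    fix w
    have "(norm (fourier k (r *\<^sub>R w)))\<^sup>2 \<le> C\<^sup>2"
      using C by (intro power_mono) auto
    then show "(norm (fourier h (r *\<^sub>R w)))\<^sup>2 \<le> C\<^sup>2 * (norm (fourier u (r *\<^sub>R w)))\<^sup>2"
      unfolding h_def fourier_convolve[OF u k] norm_mult power_mult_distrib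
      by (subst mult.commute) (intro mult_right_mono, auto)
  qed (intro bd h integrable_mult_right u)+
  then have "(1 / c) ^ DIM('a) * (\<integral>y. Re (convolve h (involution h) ((1 / c) *\<^sub>R y)) * \<phi> y \<partial>lborel)
    \<le> C\<^sup>2 * ((1 / c) ^ DIM('a) * (\<integral>y. Re (convolve u (involution u) ((1 / c) *\<^sub>R y)) * \<phi> y \<partial>lborel))"
    unfolding integral_mult_right_zero key[OF h] key[OF u] .
  then have "(1 / c) ^ DIM('a) * (\<integral>y. Re (convolve h (involution h) ((1 / c) *\<^sub>R y)) * \<phi> y \<partial>lborel)
    \<le> (1 / c) ^ DIM('a) * (C\<^sup>2 * (\<integral>y. Re (convolve u (involution u) ((1 / c) *\<^sub>R y)) * \<phi> y \<partial>lborel))"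
    by (simp only: mult.left_commute)
  then have 1: "(\<integral>y. Re (convolve h (involution h) ((1 / c) *\<^sub>R y)) * \<phi> y \<partial>lborel)
    \<le> C\<^sup>2 * (\<integral>y. Re (convolve u (involution u) ((1 / c) *\<^sub>R y)) * \<phi> y \<partial>lborel)"
    using c by (subst (asm) mult_le_cancel_left_pos) auto
  define E where "E = (\<integral>x. (norm (u x))\<^sup>2 \<partial>lborel)"
  have E: "E \<ge> 0" unfolding E_def by simp
  have Re_le: "\<bar>Re (convolve u (involution u) z)\<bar> \<le> E" for z
    unfolding E_def by (rule order_trans[OF abs_Re_le_cmod norm_autocorrelation_le[OF u2]])
  have [measurable]: "convolve u (involution u) \<in> borel_measurable borel"
    using integrable_convolve[OF u integrable_involution[OF u]] by auto
  have [measurable]: "\<phi> \<in> borel_measurable borel" using \<phi> by auto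
  have "(\<integral>y. Re (convolve u (involution u) ((1 / c) *\<^sub>R y)) * \<phi> y \<partial>lborel) \<le> (\<integral>y. E * \<phi> y \<partial>lborel)"
  proof (rule integral_mono)
    show i: "integrable lborel (\<lambda>y. E * \<phi> y)" using \<phi> by (intro integrable_mult_right)
    show "integrable lborel (\<lambda>y. Re (convolve u (involution u) ((1 / c) *\<^sub>R y)) * \<phi> y)"
    proof (rule Bochner_Integration.integrable_bound[OF i])
      show "(\<lambda>y. Re (convolve u (involution u) ((1 / c) *\<^sub>R y)) * \<phi> y) \<in> borel_measurable lborel"
        by measurable
      show "AE y in lborel. norm (Re (convolve u (involution u) ((1 / c) *\<^sub>R y)) * \<phi> y) \<le> norm (E * \<phi> y)"
        using Re_le \<phi>(2) E by (intro AE_I2) (simp only: real_norm_def abs_mult abs_of_nonneg mult_right_mono)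
    qed
    show "Re (convolve u (involution u) ((1 / c) *\<^sub>R y)) * \<phi> y \<le> E * \<phi> y" for y
      using Re_le[of "(1 / c) *\<^sub>R y"] \<phi>(2) by (intro mult_right_mono) auto
  qed
  then have "C\<^sup>2 * (\<integral>y. Re (convolve u (involution u) ((1 / c) *\<^sub>R y)) * \<phi> y \<partial>lborel)
      \<le> C\<^sup>2 * (E * (\<integral>y. \<phi> y \<partial>lborel))"
    unfolding integral_mult_right_zero by (intro mult_left_mono) auto
  with 1 show ?thesis
    unfolding E_def \<phi>_def by (simp add: mult.assoc)
qed

lemma norm_convolve_le_of_bounded:
  fixes u k :: "'a::euclidean_space cfun"
  assumes k: "integrable lborel k" and D: "\<And>x. norm (u x) \<le> D"
  shows "norm (convolve u k y) \<le> D * (\<integral>x. norm (k x) \<partial>lborel)"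
proof -
  have i: "integrable lborel (\<lambda>x. norm (k (y - x)))"
    using k by (intro Bochner_Integration.integrable_norm) (simp add: integrable_lborel_diff_left)
  have D0: "D \<ge> 0" by (rule order_trans[OF norm_ge_zero D])
  have "norm (convolve u k y) \<le> (\<integral>x. norm (u x * k (y - x)) \<partial>lborel)"
    unfolding convolve_def by (rule integral_norm_bound)
  also have "\<dots> \<le> (\<integral>x. D * norm (k (y - x)) \<partial>lborel)"
    by (rule integral_mono'[OF integrable_mult_right[OF i]])
       (use D D0 in \<open>simp_all add: norm_mult mult_right_mono\<close>)
  also have "\<dots> = D * (\<integral>x. norm (k x) \<partial>lborel)"
    by (simp only: integral_mult_right_zero integral_lborel_diff_left[of "\<lambda>x. norm (k x)"])
  finally show ?thesis .
qed

lemma convolve_norm_le_bounded_L1: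
  fixes u k :: "'a::euclidean_space cfun"
  assumes u: "integrable lborel u" and D: "\<And>x. norm (u x) \<le> D" and k: "integrable lborel k"
    and C: "\<And>w. norm (fourier k w) \<le> C"
  shows "convolve u k \<in> L2"
    and "(\<integral>x. (norm (convolve u k x))\<^sup>2 \<partial>lborel) \<le> C\<^sup>2 * (\<integral>x. (norm (u x))\<^sup>2 \<partial>lborel)"
proof -
  define h where "h = convolve u k"
  define \<phi> where "\<phi> = (\<lambda>y::'a. exp (- (norm y)\<^sup>2 / 2))"
  have \<phi>: "integrable lborel \<phi>" "\<And>y. \<phi> y > 0"
    using integrable_gaussian by (auto simp: \<phi>_def)
  have u2: "u \<in> L2" by (rule bounded_L1_imp_L2[OF u D])
  have h: "integrable lborel h" unfolding h_def by (rule integrable_convolve[OF u k])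
  have hD: "norm (h y) \<le> D * (\<integral>x. norm (k x) \<partial>lborel)" for y
    unfolding h_def by (rule norm_convolve_le_of_bounded[OF k D])
  have h2: "h \<in> L2" by (rule bounded_L1_imp_L2[OF h hD])
  then show "convolve u k \<in> L2" unfolding h_def .
  define E where "E = (\<integral>x. (norm (h x))\<^sup>2 \<partial>lborel)"
  have E: "E \<ge> 0" unfolding E_def by simp
  have Re_le: "\<bar>Re (convolve h (involution h) z)\<bar> \<le> E" for z
    unfolding E_def by (rule order_trans[OF abs_Re_le_cmod norm_autocorrelation_le[OF h2]])
  have [measurable]: "convolve h (involution h) \<in> borel_measurable borel"
    using integrable_convolve[OF h integrable_involution[OF h]] by auto
  have [measurable]: "\<phi> \<in> borel_measurable borel" using \<phi> by auto
  have "(\<lambda>n. \<integral>y. Re (convolve h (involution h) ((1 / real (Suc n)) *\<^sub>R y)) * \<phi> y \<partial>lborel)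
      \<longlonglongrightarrow> (\<integral>y. E * \<phi> y \<partial>lborel)"
  proof (rule integral_dominated_convergence)
    show "integrable lborel (\<lambda>y. E * \<phi> y)" using \<phi> by (intro integrable_mult_right)
    show "AE y in lborel. (\<lambda>n. Re (convolve h (involution h) ((1 / real (Suc n)) *\<^sub>R y)) * \<phi> y) \<longlonglongrightarrow> E * \<phi> y"
    proof (rule AE_I2)
      fix y :: 'a
      have "(\<lambda>n. (1 / real (Suc n)) *\<^sub>R y) \<longlonglongrightarrow> 0 *\<^sub>R y"
        using LIMSEQ_inverse_real_of_nat by (intro tendsto_scaleR tendsto_const) (simp add: inverse_eq_divide)
      then have "(\<lambda>n. (1 / real (Suc n)) *\<^sub>R y) \<longlonglongrightarrow> 0" by simp
      from tendsto_Re[OF autocorrelation_tendsto[OF h hD this]]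
      have "(\<lambda>n. Re (convolve h (involution h) ((1 / real (Suc n)) *\<^sub>R y))) \<longlonglongrightarrow> E"
        unfolding autocorrelation_0 E_def Re_complex_of_real .
      then show "(\<lambda>n. Re (convolve h (involution h) ((1 / real (Suc n)) *\<^sub>R y)) * \<phi> y) \<longlonglongrightarrow> E * \<phi> y"
        by (intro tendsto_mult tendsto_const)
    qed
    show "AE y in lborel. norm (Re (convolve h (involution h) ((1 / real (Suc n)) *\<^sub>R y)) * \<phi> y) \<le> E * \<phi> y" for n
      using Re_le \<phi>(2) by (intro AE_I2) (simp only: real_norm_def abs_mult abs_of_pos mult_right_mono less_imp_le)
  qed measurable
  then have "(\<integral>y. E * \<phi> y \<partial>lborel) \<le> C\<^sup>2 * (\<integral>x. (norm (u x))\<^sup>2 \<partial>lborel) * (\<integral>y. \<phi> y \<partial>lborel)"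
    by (rule LIMSEQ_le_const2)
       (use gaussian_autocorrelation_le[OF u k C _ u2] in \<open>auto simp: h_def \<phi>_def\<close>)
  moreover have "(\<integral>y. \<phi> y \<partial>lborel) > 0"
  proof -
    have "(\<integral>y. \<phi> y \<partial>lborel) \<noteq> 0"
    proof
      assume "(\<integral>y. \<phi> y \<partial>lborel) = 0"
      then have "AE y in lborel. \<phi> y = 0"
        using integral_nonneg_eq_0_iff_AE[OF \<phi>(1)] \<phi>(2) by (simp add: less_imp_le)
      then have "AE y in (lborel :: 'a measure). False"
        by eventually_elim (use \<phi>(2) less_irrefl in metis)
      then show False by (simp add: eventually_False ae_filter_eq_bot_iff)
    qed
    moreover have "(\<integral>y. \<phi> y \<partial>lborel) \<ge> 0" using \<phi>(2) by (simp add: less_imp_le)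
    ultimately show ?thesis by linarith
  qed
  ultimately show "(\<integral>x. (norm (convolve u k x))\<^sup>2 \<partial>lborel) \<le> C\<^sup>2 * (\<integral>x. (norm (u x))\<^sup>2 \<partial>lborel)"
    unfolding E_def h_def integral_mult_right_zero by (simp only: mult_le_cancel_right_pos)
qed

lemma ennreal_sqrt_power2: "(ennreal_sqrt x)\<^sup>2 = x"
  by (cases x) (auto simp: ennreal_sqrt_def ennreal_power power2_eq_square[of top])

lemma ennreal_sqrt_le:
  assumes "x \<le> y\<^sup>2"
  shows "ennreal_sqrt x \<le> y"
proof (cases y)
  case (real r)
  with assms have "x \<le> ennreal (r\<^sup>2)" by (simp add: ennreal_power)
  with real show ?thesis
    by (cases x) (auto simp: ennreal_sqrt_def real_le_lsqrt top_unique)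
qed simp

lemma l2norm_power2: "(l2norm f)\<^sup>2 = (\<integral>\<^sup>+x. ennreal ((norm (f x))\<^sup>2) \<partial>lborel)"
  unfolding l2norm_def by (rule ennreal_sqrt_power2)

lemma L2_measurable: "f \<in> L2 \<Longrightarrow> f \<in> borel_measurable borel"
  by (simp add: L2_def)

lemma l2norm_power2_eq_integral:
  "f \<in> L2 \<Longrightarrow> (l2norm f)\<^sup>2 = ennreal (\<integral>x. (norm (f x))\<^sup>2 \<partial>lborel)"
  unfolding l2norm_power2 by (rule nn_integral_eq_integral) (auto simp: L2_def)

lemma L2_iff: "f \<in> L2 \<longleftrightarrow> f \<in> borel_measurable borel \<and> (l2norm f)\<^sup>2 < \<infinity>"
  unfolding L2_def l2norm_power2 integrable_iff_bounded by auto

lemma l2norm_cong_AE: "AE x in lborel. f x = g x \<Longrightarrow> l2norm f = l2norm g"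
  unfolding l2norm_def by (intro arg_cong[where f=ennreal_sqrt] nn_integral_cong_AE) auto

lemma l2norm_eq_0_imp_AE:
  assumes "f \<in> borel_measurable borel" "l2norm f = 0"
  shows "AE x in lborel. f x = 0"
proof -
  have [measurable]: "f \<in> borel_measurable borel" by fact
  have "(\<integral>\<^sup>+x. ennreal ((norm (f x))\<^sup>2) \<partial>lborel) = 0"
    using l2norm_power2[of f] assms(2) by simp
  then show ?thesis
    by (subst (asm) nn_integral_0_iff_AE) auto
qed

lemma translate_L2:
  assumes f: "f \<in> L2"
  shows "translate t f \<in> L2"
proof -
  have [measurable]: "f \<in> borel_measurable borel" using f by (rule L2_measurable)
  have "(\<lambda>x. f (x - t)) \<in> borel_measurable borel" by measurable
  moreover have "integrable lborel (\<lambda>x. (norm (f (x - t)))\<^sup>2)"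
    using f integrable_lborel_diff_right[of "\<lambda>x. (norm (f x))\<^sup>2"] by (simp add: L2_def)
  ultimately show ?thesis by (simp add: L2_def translate_def)
qed

lemma zero_L2: "(\<lambda>_. 0) \<in> L2"
  by (simp add: L2_def)

lemma borel_measurable_convolve:
  assumes [measurable]: "f \<in> borel_measurable borel" "k \<in> borel_measurable borel"
  shows "convolve f k \<in> borel_measurable borel"
  unfolding convolve_def[abs_def] by measurable

lemma convolve_cong_AE:
  assumes uv: "AE x in lborel. u x = v x" and L2: "u \<in> L2" "v \<in> L2" "k \<in> L2"
  shows "convolve u k = convolve v k"
proof
  fix y
  note L2[THEN L2_measurable, measurable]
  show "convolve u k y = convolve v k y"
    unfolding convolve_def
    by (rule Bochner_Integration.integral_cong_AE) (measurable, use uv in auto)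
qed

lemma convolve_translate: "convolve (translate t u) k = translate t (convolve u k)"
proof
  fix y
  show "convolve (translate t u) k y = translate t (convolve u k) y"
    using integral_lborel_diff_right[of "\<lambda>x. u x * k (y - t - x)" t]
    by (simp add: convolve_def translate_def algebra_simps)
qed

lemma l2norm_convolve_le:
  fixes u k :: "'a::euclidean_space cfun"
  assumes u: "u \<in> L2" and k: "k \<in> L1" "k \<in> L2" and C: "\<And>w. norm (fourier k w) \<le> C"
  shows "(l2norm (convolve u k))\<^sup>2 \<le> ennreal (C\<^sup>2) * (l2norm u)\<^sup>2"
proof -
  note [measurable] = L2_measurable[OF u] L2_measurable[OF k(2)]
  define T where "T m = {x. norm x \<le> real m \<and> norm (u x) \<le> real m}" for m :: nat
  define v where "v m x = indicator (T m) x *\<^sub>R u x" for m x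
  have [measurable]: "T m \<in> sets borel" for m unfolding T_def by measurable
  have [measurable]: "v m \<in> borel_measurable borel" for m unfolding v_def by measurable
  have v_le: "norm (v m x) \<le> norm (u x)" for m x
    unfolding v_def by (simp add: indicator_def)
  have v_bd: "norm (v m x) \<le> real m" for m x
    unfolding v_def T_def by (simp add: indicator_def)
  have v_int: "integrable lborel (v m)" for m
  proof (rule Bochner_Integration.integrable_bound)
    show "integrable lborel (\<lambda>x::'a. indicator (cball 0 (real m)) x * real m)"
      by (intro integrable_mult_left integrable_real_indicator)
         (use emeasure_lborel_cball_finite[of "0::'a" "real m"] in simp_all)
    show "AE x in lborel. norm (v m x) \<le> norm (indicator (cball 0 (real m)) x * real m)"
      using v_bd by (intro AE_I2) (auto simp: v_def T_def indicator_def)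
  qed measurable
  have k1: "integrable lborel k" using k by (simp add: L1_def)
  have bound: "(\<integral>\<^sup>+y. ennreal ((norm (convolve (v m) k y))\<^sup>2) \<partial>lborel) \<le> ennreal (C\<^sup>2) * (l2norm u)\<^sup>2" for m
  proof -
    have "(\<integral>\<^sup>+y. ennreal ((norm (convolve (v m) k y))\<^sup>2) \<partial>lborel)
        = ennreal (\<integral>x. (norm (convolve (v m) k x))\<^sup>2 \<partial>lborel)"
      using l2norm_power2_eq_integral[OF convolve_norm_le_bounded_L1(1)[OF v_int v_bd k1 C]]
      unfolding l2norm_power2 .
    also have "\<dots> \<le> ennreal (C\<^sup>2 * (\<integral>x. (norm (v m x))\<^sup>2 \<partial>lborel))"
      by (intro ennreal_leI convolve_norm_le_bounded_L1(2)[OF v_int v_bd k1 C])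
    also have "\<dots> = ennreal (C\<^sup>2) * (\<integral>\<^sup>+x. ennreal ((norm (v m x))\<^sup>2) \<partial>lborel)"
      using l2norm_power2_eq_integral[OF bounded_L1_imp_L2[OF v_int v_bd]]
      unfolding l2norm_power2 by (simp add: ennreal_mult)
    also have "\<dots> \<le> ennreal (C\<^sup>2) * (\<integral>\<^sup>+x. ennreal ((norm (u x))\<^sup>2) \<partial>lborel)"
      using v_le by (intro mult_left_mono nn_integral_mono ennreal_leI power_mono) auto
    finally show ?thesis unfolding l2norm_power2 .
  qed
  have lim: "(\<lambda>m. convolve (v m) k y) \<longlonglongrightarrow> convolve u k y" for y
    unfolding convolve_def
  proof (rule integral_dominated_convergence)
    show "integrable lborel (\<lambda>x. norm (u x * k (y - x)))"
      by (intro Bochner_Integration.integrable_norm integrable_convolve_L2 u k)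
    show "AE x in lborel. norm (v m x * k (y - x)) \<le> norm (u x * k (y - x))" for m
      using v_le by (intro AE_I2) (simp add: norm_mult mult_right_mono)
    show "AE x in lborel. (\<lambda>m. v m x * k (y - x)) \<longlonglongrightarrow> u x * k (y - x)"
    proof (intro AE_I2 tendsto_mult tendsto_const tendsto_eventually)
      fix x
      obtain m0 where m0: "norm x + norm (u x) \<le> real m0"
        using real_arch_simple by blast
      have "v m x = u x" if "m \<ge> m0" for m
      proof -
        have "norm x + norm (u x) \<le> real m"
          using m0 that by linarith
        then have "x \<in> T m"
          unfolding T_def using norm_ge_zero[of x] norm_ge_zero[of "u x"]
          by (simp del: norm_ge_zero)
        then show ?thesis by (simp add: v_def)
      qed
      then show "eventually (\<lambda>m. v m x = u x) sequentially"
        by (auto simp: eventually_sequentially)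
    qed
  qed measurable
  have "(l2norm (convolve u k))\<^sup>2 = (\<integral>\<^sup>+y. liminf (\<lambda>m. ennreal ((norm (convolve (v m) k y))\<^sup>2)) \<partial>lborel)"
    unfolding l2norm_power2
  proof (rule nn_integral_cong)
    fix y
    have "(\<lambda>m. ennreal ((norm (convolve (v m) k y))\<^sup>2)) \<longlonglongrightarrow> ennreal ((norm (convolve u k y))\<^sup>2)"
      by (intro tendsto_ennrealI tendsto_power tendsto_norm lim)
    from lim_imp_Liminf[OF _ this]
    show "ennreal ((norm (convolve u k y))\<^sup>2) = liminf (\<lambda>m. ennreal ((norm (convolve (v m) k y))\<^sup>2))"
      by simp
  qed
  also have "\<dots> \<le> liminf (\<lambda>m. \<integral>\<^sup>+y. ennreal ((norm (convolve (v m) k y))\<^sup>2) \<partial>lborel)"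
  proof (rule nn_integral_liminf)
    fix m
    have [measurable]: "convolve (v m) k \<in> borel_measurable borel"
      by (intro borel_measurable_convolve) measurable
    show "(\<lambda>y. ennreal ((norm (convolve (v m) k y))\<^sup>2)) \<in> borel_measurable lborel" by measurable
  qed
  also have "\<dots> \<le> ennreal (C\<^sup>2) * (l2norm u)\<^sup>2"
    using bound by (intro Liminf_le always_eventually) auto
  finally show ?thesis .
qed

lemma AE_le_imp_le_continuous:
  fixes F :: "'a::euclidean_space \<Rightarrow> real"
  assumes F: "continuous_on UNIV F" and le: "AE w in lborel. F w \<le> K"
  shows "F w \<le> K"
proof (rule ccontr)
  assume "\<not> F w \<le> K"
  then have ne: "{w. K < F w} \<noteq> {}" unfolding not_le by blast
  have op: "open {w. K < F w}"
    using F by (intro open_Collect_less) auto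
  have "{w. K < F w} \<in> null_sets lborel"
    using le op by (subst (asm) AE_iff_null) (auto simp: not_le)
  then have "negligible {w. K < F w}"
    by (simp add: negligible_iff_null_sets null_sets_completionI)
  with open_not_negligible[OF op ne] show False by blast
qed

lemma norm_exp_diff_le: "norm (exp (\<i> * complex_of_real a) - exp (\<i> * complex_of_real b)) \<le> \<bar>a - b\<bar>"
proof -
  have "exp (\<i> * complex_of_real a) - exp (\<i> * complex_of_real b)
      = exp (\<i> * complex_of_real b) * (exp (\<i> * complex_of_real (a - b)) - 1)"
    by (simp add: algebra_simps exp_add[symmetric])
  also have "norm \<dots> = norm (exp (\<i> * complex_of_real (a - b)) - 1)"
    by (simp add: norm_mult)
  also have "\<dots> \<le> \<bar>a - b\<bar>"
    using iexp_approx1[of "a - b" 0] by simp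
  finally show ?thesis .
qed

lemma l2norm_translate_convolve_diff_le:
  fixes u \<psi> :: "'a::euclidean_space cfun"
  assumes u: "u \<in> L2" and \<psi>: "\<psi> \<in> L1" "\<psi> \<in> L2"
    and K: "AE w in lborel. norm (fourier \<psi> w) * norm w \<le> K"
  shows "(l2norm (\<lambda>x. translate s (convolve u \<psi>) x - translate t (convolve u \<psi>) x))\<^sup>2
    \<le> ennreal ((2 * pi * norm (s - t) * K)\<^sup>2) * (l2norm u)\<^sup>2"
proof -
  define k where "k x = translate s \<psi> x - translate t \<psi> x" for x
  have \<psi>1: "integrable lborel \<psi>" using \<psi> by (simp add: L1_def)
  have t1: "integrable lborel (translate z \<psi>)" for z
    unfolding translate_def using \<psi>1 by (simp add: integrable_lborel_diff_right)
  have k1: "k \<in> L1" unfolding L1_def k_def using t1 by simp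
  have k2: "k \<in> L2"
  proof -
    note [measurable] = L2_measurable[OF translate_L2[OF \<psi>(2)]]
    have sq: "integrable lborel (\<lambda>x. (norm (translate z \<psi> x))\<^sup>2)" for z
      using translate_L2[OF \<psi>(2)] by (simp add: L2_def)
    have "integrable lborel (\<lambda>x. (norm (k x))\<^sup>2)"
    proof (rule Bochner_Integration.integrable_bound)
      show "integrable lborel (\<lambda>x. 2 * (norm (translate s \<psi> x))\<^sup>2 + 2 * (norm (translate t \<psi> x))\<^sup>2)"
        by (intro Bochner_Integration.integrable_add integrable_mult_right sq)
      show "(\<lambda>x. (norm (k x))\<^sup>2) \<in> borel_measurable lborel" unfolding k_def by measurable
      have "(norm (a - b))\<^sup>2 \<le> 2 * (norm a)\<^sup>2 + 2 * (norm b)\<^sup>2" for a b :: complex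
      proof -
        have "(norm (a - b))\<^sup>2 \<le> (norm a + norm b)\<^sup>2"
          by (intro power_mono norm_triangle_ineq4 norm_ge_zero)
        also have "\<dots> \<le> 2 * (norm a)\<^sup>2 + 2 * (norm b)\<^sup>2"
          using sum_squares_bound[of "norm a" "norm b"] by (simp add: power2_sum)
        finally show ?thesis .
      qed
      then show "AE x in lborel. norm ((norm (k x))\<^sup>2)
          \<le> norm (2 * (norm (translate s \<psi> x))\<^sup>2 + 2 * (norm (translate t \<psi> x))\<^sup>2)"
        unfolding k_def by (intro AE_I2) simp
    qed
    moreover have "k \<in> borel_measurable borel" unfolding k_def by measurable
    ultimately show ?thesis by (simp add: L2_def)
  qed
  have K': "norm (fourier \<psi> w) * norm w \<le> K" for w
    by (rule AE_le_imp_le_continuous[OF _ K]) (intro continuous_intros continuous_fourier \<psi>1)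
  have "norm (fourier k w) \<le> 2 * pi * norm (s - t) * K" for w
  proof -
    let ?e = "\<lambda>z. exp (\<i> * complex_of_real (- 2 * pi * (z \<bullet> w)))"
    have "fourier k w = fourier (translate s \<psi>) w - fourier (translate t \<psi>) w"
      unfolding fourier_def k_def left_diff_distrib
      by (rule Bochner_Integration.integral_diff[OF integrable_fourier_kernel[OF t1] integrable_fourier_kernel[OF t1]])
    also have "\<dots> = (?e s - ?e t) * fourier \<psi> w"
      unfolding fourier_translate by (simp add: algebra_simps)
    also have "norm \<dots> \<le> \<bar>- 2 * pi * (s \<bullet> w) - (- 2 * pi * (t \<bullet> w))\<bar> * norm (fourier \<psi> w)"
      unfolding norm_mult by (intro mult_right_mono norm_exp_diff_le norm_ge_zero)
    also have "\<bar>- 2 * pi * (s \<bullet> w) - (- 2 * pi * (t \<bullet> w))\<bar> = 2 * pi * \<bar>(s - t) \<bullet> w\<bar>"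
    proof -
      have "- 2 * pi * (s \<bullet> w) - (- 2 * pi * (t \<bullet> w)) = - (2 * pi) * ((s - t) \<bullet> w)"
        by (simp add: inner_diff_left algebra_simps)
      then show ?thesis by (simp only: abs_mult abs_minus_cancel) simp
    qed
    also have "2 * pi * \<bar>(s - t) \<bullet> w\<bar> * norm (fourier \<psi> w)
        \<le> 2 * pi * (norm (s - t) * norm w) * norm (fourier \<psi> w)"
      by (intro mult_right_mono mult_left_mono Cauchy_Schwarz_ineq2) auto
    also have "\<dots> = 2 * pi * norm (s - t) * (norm (fourier \<psi> w) * norm w)"
      by (simp add: mult_ac)
    also have "\<dots> \<le> 2 * pi * norm (s - t) * K"
      by (intro mult_left_mono K') auto
    finally show ?thesis .
  qed
  moreover have "convolve u k = (\<lambda>x. translate s (convolve u \<psi>) x - translate t (convolve u \<psi>) x)"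
  proof
    fix y
    show "convolve u k y = translate s (convolve u \<psi>) y - translate t (convolve u \<psi>) y"
      using Bochner_Integration.integral_diff[OF
          integrable_convolve_L2[OF u \<psi>(2), of "y - s"] integrable_convolve_L2[OF u \<psi>(2), of "y - t"]]
      by (simp add: convolve_def translate_def k_def algebra_simps)
  qed
  ultimately show ?thesis
    using l2norm_convolve_le[OF u k1 k2] by simp
qed

subsection \<open>Layers and paths\<close>

lemma infsum_ennreal_le:
  fixes F :: "'q \<Rightarrow> ennreal"
  assumes "\<And>X. finite X \<Longrightarrow> X \<subseteq> Q \<Longrightarrow> sum F X \<le> c"
  shows "infsum F Q \<le> c"
  using assms by (subst nonneg_infsum_complete) (auto intro!: SUP_least)

lemma sum_le_infsum_ennreal:
  fixes F :: "'q \<Rightarrow> ennreal"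
  assumes "finite X" "X \<subseteq> Q"
  shows "sum F X \<le> infsum F Q"
  using assms by (subst nonneg_infsum_complete) (auto intro!: SUP_upper)

lemma lipschitz_op_L2: "lipschitz_op C N \<Longrightarrow> f \<in> L2 \<Longrightarrow> N f \<in> L2"
  by (simp add: lipschitz_op_def)

lemma lipschitz_op_cong_AE:
  assumes N: "lipschitz_op C N" and fh: "f \<in> L2" "h \<in> L2" and eq: "AE x in lborel. f x = h x"
  shows "AE x in lborel. N f x = N h x"
proof -
  note [measurable] = L2_measurable[OF lipschitz_op_L2[OF N fh(1)]] L2_measurable[OF lipschitz_op_L2[OF N fh(2)]]
  have "l2norm (\<lambda>x. f x - h x) = l2norm (\<lambda>_::'a. 0)"
    using eq by (intro l2norm_cong_AE) auto
  also have "\<dots> = 0" by (simp add: l2norm_def ennreal_sqrt_def)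
  finally have "l2norm (\<lambda>x. f x - h x) = 0" .
  moreover have "l2norm (\<lambda>x. N f x - N h x) \<le> ennreal C * l2norm (\<lambda>x. f x - h x)"
    using N fh unfolding lipschitz_op_def by blast
  ultimately have "l2norm (\<lambda>x. N f x - N h x) = 0" by simp
  then have "AE x in lborel. N f x - N h x = 0"
    by (intro l2norm_eq_0_imp_AE) measurable
  then show ?thesis by eventually_elim simp
qed

lemma lipschitz_op_l2norm_le:
  assumes N: "lipschitz_op C N" and f: "f \<in> L2"
  shows "(l2norm (N f))\<^sup>2 \<le> ennreal (C\<^sup>2) * (l2norm f)\<^sup>2"
proof -
  have "l2norm (\<lambda>x. N f x - N (\<lambda>_. 0) x) \<le> ennreal C * l2norm (\<lambda>x. f x - 0)"
    using N f zero_L2 unfolding lipschitz_op_def by blast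
  moreover have "l2norm (\<lambda>x. N f x - N (\<lambda>_. 0) x) = l2norm (N f)"
    using N by (intro l2norm_cong_AE) (auto simp: lipschitz_op_def)
  ultimately have "l2norm (N f) \<le> ennreal C * l2norm f" by simp
  then have "(l2norm (N f))\<^sup>2 \<le> (ennreal C * l2norm f)\<^sup>2"
    by (intro power_mono) auto
  also have "\<dots> = ennreal (C\<^sup>2) * (l2norm f)\<^sup>2"
    using N by (simp add: power_mult_distrib ennreal_power lipschitz_op_def)
  finally show ?thesis .
qed

lemma semi_discrete_frame_convolve:
  fixes f :: "'b::euclidean_space cfun"
  assumes fr: "semi_discrete_frame \<Lambda> g A B" and f: "f \<in> L2"
  shows "l \<in> \<Lambda> \<Longrightarrow> convolve f (g l) \<in> L2"
    and "finite F \<Longrightarrow> F \<subseteq> \<Lambda> \<Longrightarrow> (\<Sum>l\<in>F. (l2norm (convolve f (g l)))\<^sup>2) \<le> ennreal B * (l2norm f)\<^sup>2"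
proof -
  have inner: "l2inner f (translate b (involution (g l))) = convolve f (g l) b" for l b and f :: "'b cfun"
    by (simp add: l2inner_def translate_def involution_def convolve_def)
  have le: "(\<Sum>\<^sub>\<infinity>l\<in>\<Lambda>. (l2norm (convolve f (g l)))\<^sup>2) \<le> ennreal B * (l2norm f)\<^sup>2"
    using fr f unfolding semi_discrete_frame_def inner l2norm_power2[symmetric] by blast
  show sum_le: "(\<Sum>l\<in>F. (l2norm (convolve f (g l)))\<^sup>2) \<le> ennreal B * (l2norm f)\<^sup>2"
    if "finite F" "F \<subseteq> \<Lambda>" for F
    by (rule order_trans[OF sum_le_infsum_ennreal[OF that] le])
  show "convolve f (g l) \<in> L2" if l: "l \<in> \<Lambda>"
  proof -
    have "g l \<in> L2" using fr l by (auto simp: semi_discrete_frame_def)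
    then have "convolve f (g l) \<in> borel_measurable borel"
      by (intro borel_measurable_convolve L2_measurable f)
    moreover have "(l2norm (convolve f (g l)))\<^sup>2 \<le> ennreal B * (l2norm f)\<^sup>2"
      using sum_le[of "{l}"] l by simp
    moreover have "ennreal B * (l2norm f)\<^sup>2 < \<infinity>"
      using f by (simp add: L2_iff ennreal_mult_less_top)
    ultimately show ?thesis
      unfolding L2_iff by (auto intro: le_less_trans)
  qed
qed

lemma
  fixes f :: "'a::euclidean_space cfun"
  assumes v: "P (M (convolve f h)) \<in> L2" and s: "s > 0"
  shows layer_op_L2: "layer_op s M P h f \<in> L2"
    and l2norm_layer_op: "(l2norm (layer_op s M P h f))\<^sup>2 = (l2norm (P (M (convolve f h))))\<^sup>2"
proof -
  define v where "v = P (M (convolve f h))"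
  note [measurable] = L2_measurable[OF v, folded v_def]
  have scale: "(s powr (real DIM('a) / 2))\<^sup>2 = s ^ DIM('a)"
    using s by (simp add: power2_eq_square powr_add[symmetric] powr_realpow)
  have "(l2norm v)\<^sup>2 = ennreal (\<bar>s\<bar> ^ DIM('a)) * (\<integral>\<^sup>+x. ennreal ((norm (v (0 + s *\<^sub>R x)))\<^sup>2) \<partial>lborel)"
    unfolding l2norm_power2 using s by (intro nn_integral_lborel_affine) auto
  also have "\<dots> = (\<integral>\<^sup>+x. ennreal (s ^ DIM('a)) * ennreal ((norm (v (s *\<^sub>R x)))\<^sup>2) \<partial>lborel)"
    using s by (subst nn_integral_cmult) auto
  also have "\<dots> = (l2norm (layer_op s M P h f))\<^sup>2"
    unfolding l2norm_power2 using s
    by (intro nn_integral_cong)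
       (simp add: layer_op_def v_def norm_mult power_mult_distrib scale ennreal_mult)
  finally show eq: "(l2norm (layer_op s M P h f))\<^sup>2 = (l2norm (P (M (convolve f h))))\<^sup>2"
    unfolding v_def ..
  have "layer_op s M P h f \<in> borel_measurable borel"
    unfolding layer_op_def v_def[symmetric] by measurable
  with v show "layer_op s M P h f \<in> L2"
    unfolding L2_iff eq by simp
qed

lemma layer_op_sum_le:
  assumes fr: "semi_discrete_frame \<Lambda> g A B" and M: "lipschitz_op L M" and P: "lipschitz_op R P"
    and adm: "B * L\<^sup>2 * R\<^sup>2 \<le> 1" and s: "s > 0" and f: "f \<in> L2"
    and F: "finite F" "F \<subseteq> \<Lambda>"
  shows "(\<Sum>l\<in>F. (l2norm (layer_op s M P (g l) f))\<^sup>2) \<le> (l2norm f)\<^sup>2"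
proof -
  have B: "B > 0" using fr by (auto simp: semi_discrete_frame_def)
  have "(\<Sum>l\<in>F. (l2norm (layer_op s M P (g l) f))\<^sup>2)
      \<le> (\<Sum>l\<in>F. ennreal (R\<^sup>2) * (ennreal (L\<^sup>2) * (l2norm (convolve f (g l)))\<^sup>2))"
  proof (rule sum_mono)
    fix l assume "l \<in> F"
    then have c: "convolve f (g l) \<in> L2"
      using F by (intro semi_discrete_frame_convolve(1)[OF fr f]) auto
    have m: "M (convolve f (g l)) \<in> L2" by (rule lipschitz_op_L2[OF M c])
    have "(l2norm (layer_op s M P (g l) f))\<^sup>2 = (l2norm (P (M (convolve f (g l)))))\<^sup>2"
      by (rule l2norm_layer_op[of P M f "g l" s, OF lipschitz_op_L2[OF P m] s])
    also have "\<dots> \<le> ennreal (R\<^sup>2) * (l2norm (M (convolve f (g l))))\<^sup>2"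
      by (rule lipschitz_op_l2norm_le[OF P m])
    also have "\<dots> \<le> ennreal (R\<^sup>2) * (ennreal (L\<^sup>2) * (l2norm (convolve f (g l)))\<^sup>2)"
      by (intro mult_left_mono lipschitz_op_l2norm_le[OF M c]) simp
    finally show "(l2norm (layer_op s M P (g l) f))\<^sup>2
      \<le> ennreal (R\<^sup>2) * (ennreal (L\<^sup>2) * (l2norm (convolve f (g l)))\<^sup>2)" .
  qed
  also have "\<dots> = ennreal (R\<^sup>2) * (ennreal (L\<^sup>2) * (\<Sum>l\<in>F. (l2norm (convolve f (g l)))\<^sup>2))"
    by (simp only: sum_distrib_left)
  also have "\<dots> \<le> ennreal (R\<^sup>2) * (ennreal (L\<^sup>2) * (ennreal B * (l2norm f)\<^sup>2))"
    by (intro mult_left_mono semi_discrete_frame_convolve(2)[OF fr f F]) simp_all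
  also have "\<dots> = ennreal (B * L\<^sup>2 * R\<^sup>2) * (l2norm f)\<^sup>2"
    using B by (simp add: ennreal_mult mult_ac)
  also have "\<dots> \<le> 1 * (l2norm f)\<^sup>2"
    using adm by (intro mult_right_mono) auto
  finally show ?thesis by simp
qed

lemma layer_op_translate:
  fixes u :: "'a::euclidean_space cfun"
  assumes M: "lipschitz_op L M" and P: "lipschitz_op R P"
    and cM: "commutes_with_translations M" and cP: "commutes_with_translations P"
    and w: "convolve u h \<in> L2" and s: "s > 0"
  shows "AE x in lborel. layer_op s M P h (translate t u) x
    = translate ((1 / s) *\<^sub>R t) (layer_op s M P h u) x"
proof -
  define v where "v = convolve u h"
  have v: "v \<in> L2" and tv: "translate t v \<in> L2" using w translate_L2 by (auto simp: v_def)
  have Mv: "M v \<in> L2" "M (translate t v) \<in> L2" by (intro lipschitz_op_L2[OF M] v tv)+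
  have "AE x in lborel. M (translate t v) x = translate t (M v) x"
    using cM v by (auto simp: commutes_with_translations_def)
  then have "AE x in lborel. P (M (translate t v)) x = P (translate t (M v)) x"
    by (rule lipschitz_op_cong_AE[OF P Mv(2) translate_L2[OF Mv(1)]])
  moreover have "AE x in lborel. P (translate t (M v)) x = translate t (P (M v)) x"
    using cP Mv by (auto simp: commutes_with_translations_def)
  ultimately have "AE x in lborel. P (M (translate t v)) x = translate t (P (M v)) x"
    by eventually_elim simp
  from AE_lborel_affine[OF this, of s 0] s
  have "AE x in lborel. P (M (translate t v)) (s *\<^sub>R x) = translate t (P (M v)) (s *\<^sub>R x)"
    by simp
  then show ?thesis
  proof eventually_elim
    case (elim x)
    have "s *\<^sub>R (x - (1 / s) *\<^sub>R t) = s *\<^sub>R x - t"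
      using s by (simp add: scaleR_diff_right)
    with elim have "P (M (translate t v)) (s *\<^sub>R x) = P (M v) (s *\<^sub>R (x - (1 / s) *\<^sub>R t))"
      by (simp only: translate_def)
    then show ?case
      by (simp only: layer_op_def convolve_translate v_def[symmetric] translate_def[of "(1 / s) *\<^sub>R t"])
  qed
qed

lemma path_op_cong:
  "(\<And>k. k \<in> {1..n} \<Longrightarrow> q k = q' k) \<Longrightarrow> path_op g M P S n q f = path_op g M P S n q' f"
  by (induction n) simp_all

locale scattering_network =
  fixes \<Lambda> :: "nat \<Rightarrow> 'i set"
    and g :: "nat \<Rightarrow> 'i \<Rightarrow> ('a::euclidean_space) cfun"
    and out :: "nat \<Rightarrow> 'i"
    and M P :: "nat \<Rightarrow> 'a cop"
    and B L R S :: "nat \<Rightarrow> real"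
  assumes modules: "module_sequence \<Lambda> g M P B L R"
    and adm: "admissible B L R"
    and out: "\<And>k. k \<ge> 1 \<Longrightarrow> out k \<in> \<Lambda> k"
    and pooling: "\<And>k. k \<ge> 1 \<Longrightarrow> S k \<ge> 1"
    and M_translate: "\<And>k. k \<ge> 1 \<Longrightarrow> commutes_with_translations (M k)"
    and P_translate: "\<And>k. k \<ge> 1 \<Longrightarrow> commutes_with_translations (P k)"
begin

lemma frameE:
  obtains A where "semi_discrete_frame (\<Lambda> (Suc n)) (g (Suc n)) A (B (Suc n))"
  using modules by (auto simp: module_sequence_def)

lemma M_lipschitz: "lipschitz_op (L (Suc n)) (M (Suc n))"
  and P_lipschitz: "lipschitz_op (R (Suc n)) (P (Suc n))"
  using modules by (auto simp: module_sequence_def)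

lemma pooling_pos: "S (Suc n) > 0"
  using pooling[of "Suc n"] by simp

lemma atom: "l \<in> \<Lambda> (Suc n) \<Longrightarrow> g (Suc n) l \<in> L1" "l \<in> \<Lambda> (Suc n) \<Longrightarrow> g (Suc n) l \<in> L2"
  using frameE[of n] by (auto simp: semi_discrete_frame_def)

lemma convolve_atom_L2: "l \<in> \<Lambda> (Suc n) \<Longrightarrow> u \<in> L2 \<Longrightarrow> convolve u (g (Suc n) l) \<in> L2"
  using frameE[of n] semi_discrete_frame_convolve(1) by metis

lemma path_op_L2:
  assumes f: "f \<in> L2" and q: "q \<in> paths \<Lambda> out n"
  shows "m \<le> n \<Longrightarrow> path_op g M P S m q f \<in> L2"
proof (induction m)
  case (Suc m)
  then have "q (Suc m) \<in> \<Lambda> (Suc m)" using q by (force simp: paths_def)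
  then show ?case
    using Suc unfolding path_op.simps
    by (intro layer_op_L2 pooling_pos lipschitz_op_L2[OF P_lipschitz] lipschitz_op_L2[OF M_lipschitz]
        convolve_atom_L2) auto
qed (simp add: f)

lemma path_op_translate:
  assumes f: "f \<in> L2" and q: "q \<in> paths \<Lambda> out n"
  shows "m \<le> n \<Longrightarrow> AE x in lborel. path_op g M P S m q (translate t f) x
    = translate ((1 / (\<Prod>k=1..m. S k)) *\<^sub>R t) (path_op g M P S m q f) x"
proof (induction m)
  case (Suc m)
  define u where "u = path_op g M P S m q f"
  define r where "r = (1 / (\<Prod>k=1..m. S k)) *\<^sub>R t"
  define h where "h = g (Suc m) (q (Suc m))"
  have l: "q (Suc m) \<in> \<Lambda> (Suc m)" using q Suc.prems by (force simp: paths_def)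
  have u: "u \<in> L2" unfolding u_def using Suc.prems by (intro path_op_L2[OF f q]) auto
  have IH: "AE x in lborel. path_op g M P S m q (translate t f) x = translate r u x"
    unfolding r_def u_def using Suc by auto
  have "convolve (path_op g M P S m q (translate t f)) h = convolve (translate r u) h"
    using Suc.prems unfolding h_def
    by (intro convolve_cong_AE[OF IH] path_op_L2[OF translate_L2[OF f] q] translate_L2 u atom l) auto
  then have 1: "path_op g M P S (Suc m) q (translate t f)
      = layer_op (S (Suc m)) (M (Suc m)) (P (Suc m)) h (translate r u)"
    by (simp add: layer_op_def h_def)
  have 2: "path_op g M P S (Suc m) q f = layer_op (S (Suc m)) (M (Suc m)) (P (Suc m)) h u"
    by (simp add: h_def u_def)
  have 3: "(1 / (\<Prod>k=1..Suc m. S k)) *\<^sub>R t = (1 / S (Suc m)) *\<^sub>R r"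
    by (simp add: r_def)
  show ?case
    unfolding 1 2 3
    by (rule layer_op_translate[OF M_lipschitz P_lipschitz M_translate P_translate _ pooling_pos])
       (use convolve_atom_L2[OF l u] in \<open>simp_all add: h_def\<close>)
qed (simp add: translate_def)

lemma sum_path_op_le:
  assumes f: "f \<in> L2"
  shows "finite F \<Longrightarrow> F \<subseteq> paths \<Lambda> out n \<Longrightarrow> (\<Sum>q\<in>F. (l2norm (path_op g M P S n q f))\<^sup>2) \<le> (l2norm f)\<^sup>2"
proof (induction n arbitrary: F)
  case 0
  then have "F \<subseteq> {\<lambda>_. undefined}" by (simp add: paths_def)
  then have "F = {} \<or> F = {\<lambda>_. undefined}" by blast
  then show ?case by auto
next
  case (Suc n)
  define F0 where "F0 = (\<lambda>q. restrict q {1..n}) ` F"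
  define G where "G = (\<lambda>q. q (Suc n)) ` F"
  define W where "W = (\<lambda>(q, l). (l2norm (layer_op (S (Suc n)) (M (Suc n)) (P (Suc n)) (g (Suc n) l)
    (path_op g M P S n q f)))\<^sup>2)"
  let ?j = "\<lambda>q. (restrict q {1..n}, q (Suc n))"
  have q: "q \<in> (\<Pi>\<^sub>E k\<in>{1..Suc n}. \<Lambda> k - {out k})" if "q \<in> F" for q
    using Suc.prems that by (auto simp: paths_def)
  have F0: "finite F0" "F0 \<subseteq> paths \<Lambda> out n" and G: "finite G" "G \<subseteq> \<Lambda> (Suc n)"
    using Suc.prems(1) q unfolding F0_def G_def paths_def by (fastforce simp: PiE_iff)+
  have inj: "inj_on ?j F"
  proof (rule inj_onI)
    fix q q' assume qq: "q \<in> F" "q' \<in> F" and eq: "?j q = ?j q'"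
    show "q = q'"
    proof (rule PiE_ext[OF q[OF qq(1)] q[OF qq(2)]])
      fix k assume k: "k \<in> {1..Suc n}"
      show "q k = q' k"
      proof (cases "k = Suc n")
        case False
        then have "restrict q {1..n} k = q k" "restrict q' {1..n} k = q' k" using k by auto
        then show ?thesis using eq by (metis prod.inject)
      qed (use eq in simp)
    qed
  qed
  have "(\<Sum>q\<in>F. (l2norm (path_op g M P S (Suc n) q f))\<^sup>2) = (\<Sum>q\<in>F. W (?j q))"
  proof (intro sum.cong refl)
    fix q
    have "path_op g M P S n (restrict q {1..n}) f = path_op g M P S n q f"
      by (rule path_op_cong) simp
    then show "(l2norm (path_op g M P S (Suc n) q f))\<^sup>2 = W (?j q)" by (simp add: W_def)
  qed
  also have "\<dots> = sum W (?j ` F)"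
    using sum.reindex[OF inj, of W] by (simp only: o_def)
  also have "\<dots> \<le> sum W (F0 \<times> G)"
    using F0 G by (intro sum_mono2) (auto simp: F0_def G_def)
  also have "\<dots> = (\<Sum>q\<in>F0. \<Sum>l\<in>G. W (q, l))"
    by (simp add: sum.cartesian_product)
  also have "\<dots> \<le> (\<Sum>q\<in>F0. (l2norm (path_op g M P S n q f))\<^sup>2)"
  proof (rule sum_mono)
    fix q assume "q \<in> F0"
    then have u: "path_op g M P S n q f \<in> L2"
      using F0 by (intro path_op_L2[OF f]) auto
    obtain A where A: "semi_discrete_frame (\<Lambda> (Suc n)) (g (Suc n)) A (B (Suc n))"
      using frameE by blast
    have "B (Suc n) * (L (Suc n))\<^sup>2 * (R (Suc n))\<^sup>2 \<le> 1"
      using adm by (simp add: admissible_def)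
    from layer_op_sum_le[OF A M_lipschitz P_lipschitz this pooling_pos u G]
    show "(\<Sum>l\<in>G. W (q, l)) \<le> (l2norm (path_op g M P S n q f))\<^sup>2"
      by (simp add: W_def)
  qed
  also have "\<dots> \<le> (l2norm f)\<^sup>2" by (rule Suc.IH[OF F0])
  finally show ?case .
qed

lemma features_translation_bound:
  assumes K: "AE w in lborel. norm (fourier (output_atom g out n) w) * norm w \<le> K" and K0: "K \<ge> 0"
    and f: "f \<in> L2"
  shows "family_norm (paths \<Lambda> out n)
           (\<lambda>q x. features g out M P S n (translate t f) q x - translate t (features g out M P S n f q) x)
         \<le> ennreal (2 * pi * norm t * K * \<bar>1 / (\<Prod>k=1..n. S k) - 1\<bar>) * l2norm f"
proof -
  define \<psi> where "\<psi> = output_atom g out n"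
  define s where "s = (1 / (\<Prod>k=1..n. S k)) *\<^sub>R t"
  define C where "C = 2 * pi * norm t * K * \<bar>1 / (\<Prod>k=1..n. S k) - 1\<bar>"
  let ?D = "\<lambda>q x. features g out M P S n (translate t f) q x - translate t (features g out M P S n f q) x"
  have C0: "C \<ge> 0" unfolding C_def using K0 by simp
  have \<psi>: "\<psi> \<in> L1" "\<psi> \<in> L2"
    unfolding \<psi>_def output_atom_def using atom out by auto
  have "s - t = (1 / (\<Prod>k=1..n. S k) - 1) *\<^sub>R t"
    by (simp add: s_def algebra_simps)
  then have C: "2 * pi * norm (s - t) * K = C"
    by (simp add: C_def mult_ac)
  have D_le: "(l2norm (?D q))\<^sup>2 \<le> ennreal (C\<^sup>2) * (l2norm (path_op g M P S n q f))\<^sup>2"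
    if q: "q \<in> paths \<Lambda> out n" for q
  proof -
    define u where "u = path_op g M P S n q f"
    have u: "u \<in> L2" unfolding u_def by (rule path_op_L2[OF f q order_refl])
    have "convolve (path_op g M P S n q (translate t f)) \<psi> = convolve (translate s u) \<psi>"
      using path_op_translate[OF f q order_refl] unfolding s_def u_def
      by (intro convolve_cong_AE path_op_L2[OF translate_L2[OF f] q] translate_L2 \<psi>)
         (use u u_def in auto)
    then have "?D q = (\<lambda>x. translate s (convolve u \<psi>) x - translate t (convolve u \<psi>) x)"
      unfolding features_def \<psi>_def[symmetric] u_def[symmetric] convolve_translate by simp
    then show ?thesis
      using l2norm_translate_convolve_diff_le[OF u \<psi> K[folded \<psi>_def], of s t]
      unfolding C u_def by simp
  qed
  have "(\<Sum>\<^sub>\<infinity>q\<in>paths \<Lambda> out n. (l2norm (?D q))\<^sup>2) \<le> ennreal (C\<^sup>2) * (l2norm f)\<^sup>2"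
  proof (rule infsum_ennreal_le)
    fix X assume X: "finite X" "X \<subseteq> paths \<Lambda> out n"
    have "(\<Sum>q\<in>X. (l2norm (?D q))\<^sup>2) \<le> (\<Sum>q\<in>X. ennreal (C\<^sup>2) * (l2norm (path_op g M P S n q f))\<^sup>2)"
      using X by (intro sum_mono D_le) auto
    also have "\<dots> = ennreal (C\<^sup>2) * (\<Sum>q\<in>X. (l2norm (path_op g M P S n q f))\<^sup>2)"
      by (simp only: sum_distrib_left)
    also have "\<dots> \<le> ennreal (C\<^sup>2) * (l2norm f)\<^sup>2"
      by (intro mult_left_mono sum_path_op_le[OF f X]) simp
    finally show "(\<Sum>q\<in>X. (l2norm (?D q))\<^sup>2) \<le> ennreal (C\<^sup>2) * (l2norm f)\<^sup>2" .
  qed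
  also have "\<dots> = (ennreal C * l2norm f)\<^sup>2"
    using C0 by (simp add: power_mult_distrib ennreal_power)
  finally show ?thesis
    unfolding family_norm_def C_def[symmetric] by (rule ennreal_sqrt_le)
qed

end

theorem corollary1:
  fixes \<Lambda> :: "nat \<Rightarrow> 'i set"
    and g :: "nat \<Rightarrow> 'i \<Rightarrow> (real ^ 'd) \<Rightarrow> complex"
    and out :: "nat \<Rightarrow> 'i"
    and M P :: "nat \<Rightarrow> ((real ^ 'd) \<Rightarrow> complex) \<Rightarrow> ((real ^ 'd) \<Rightarrow> complex)"
    and B L R S :: "nat \<Rightarrow> real"
    and K :: real
    and f :: "(real ^ 'd) \<Rightarrow> complex"
    and t :: "real ^ 'd"
    and n :: nat
  assumes "module_sequence \<Lambda> g M P B L R"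
    and "admissible B L R"
    and "\<And>k. k \<ge> 1 \<Longrightarrow> out k \<in> \<Lambda> k"
    and "\<And>k. k \<ge> 1 \<Longrightarrow> S k \<ge> 1"
    and "\<And>k. k \<ge> 1 \<Longrightarrow> commutes_with_translations (M k)"
    and "\<And>k. k \<ge> 1 \<Longrightarrow> commutes_with_translations (P k)"
    and "K > 0"
    and "\<And>k. AE \<omega> in lborel. norm (fourier (output_atom g out k) \<omega>) * norm \<omega> \<le> K"
    and "f \<in> L2"
    and "n \<ge> 1"
  shows "family_norm (paths \<Lambda> out n)
           (\<lambda>q x. features g out M P S n (translate t f) q x - translate t (features g out M P S n f q) x)
         \<le> ennreal (2 * pi * norm t * K * \<bar>1 / (\<Prod>k=1..n. S k) - 1\<bar>) * l2norm f"
proof -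
  interpret scattering_network \<Lambda> g out M P B L R S
    by unfold_locales (use assms in auto)
  show ?thesis
    using assms(7) by (intro features_translation_bound assms(8,9)) simp
qed

end
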